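(* Let $\Gamma$ be a connected graph without loops or multiple edges. The following are equivalent: (i) $\Gamma$ is the line graph of some multi-graph; (ii) $\overline\Gamma$ is the line graph of some ordinary graph; (iii) $\overline\Pi_\Gamma$ is isomorphic (as a partial linear space) to the cotriangular space of some set $\Omega$; (iv) $\overline\Pi_\Gamma$ contains no subspace isomorphic to $\Pi_{D_4}$.
   Context: A multi-graph is a graph without loops, multiple edges allowed. Its line graph has as vertices its edges, two edges adjacent iff they meet in exactly one vertex. An ordinary graph has no loops or multiple edges. For an orthogonal $\mathbb F_2$-space $(V,Q)$ (quadratic form $Q$ on an $\mathbb F_2$-space $V$), a vector $v$ is anisotropic if $Q(v)=1$; an elliptic line is a set $\{a,b,a+b\}$ of three distinct anisotropic vectors. The orthogonal cotriangular space of $(V,Q)$ has the anisotropic vectors as points and the elliptic lines as lines; a subspace is a set of points containing the third point of every elliptic line of which it contains two points (it is a partial linear space with the lines it contains); the subspace generated by a set is the smallest subspace containing it. For a graph $\Gamma$ with vertex set $\mathcal V$: $V_\Gamma$ is the $\mathbb F_2$-space of finite subsets of $\mathcal V$ under symmetric difference, vertex $v$ identified with $\{v\}$; with a total order $<$ on $\mathcal V$, $g_\Gamma(u,w)$ is the number mod 2 of pairs $(x,y)\in u\times w$ with $x=y$ or ($x<y$ and $\{x,y\}$ an edge), $Q_\Gamma(u)=g_\Gamma(u,u)$ (independent of the order). $\Pi_\Gamma$ is the subspace of the orthogonal cotriangular space of $(V_\Gamma,Q_\Gamma)$ generated by the vertices. With $R_0$ the isotropic radical $\{v: Q_\Gamma(v)=0,\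 Q_\Gamma(v+w)=Q_\Gamma(w)\ \forall w\}$, $\overline\Pi_\Gamma$ is the image of $\Pi_\Gamma$ in $V_\Gamma/R_0$ (points and lines the images), and $\overline\Gamma$ is the graph on the images $\{v\}+R_0$ of the vertices, distinct images $a,b$ adjacent iff the induced quadratic form takes value $1$ on $a+b$. $D_4$ is the star $K_{1,3}$, and $\Pi_{D_4}$ is $\Pi_\Gamma$ for $\Gamma=D_4$. The cotriangular space of a set $\Omega$ is the partial linear space whose points are the $2$-subsets of $\Omega$ and whose lines are the triples $\{\{a,b\},\{a,c\},\{b,c\}\}$ for distinct $a,b,c\in\Omega$. *)

theory Defs
  imports
    Complex_Main
    "HOL-Library.Z2"
    "HOL-Library.Ramsey"
    "HOL-Algebra.Coset"
begin

section \<open>Graphs, multi-graphs and line graphs\<close>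

text \<open>Vertex and edge sets may be infinite. An edge of a graph is the 2-subset of its ends;
  an edge of a multi-graph is an abstract object with a 2-subset of ends.\<close>

record 'v graph =
  verts :: "'v set"
  edges :: "'v set set"

definition ordinary_graph :: "'v graph \<Rightarrow> bool" where
  "ordinary_graph G \<longleftrightarrow> edges G \<subseteq> [verts G]\<^bsup>2\<^esup>"

definition connected_graph :: "'v graph \<Rightarrow> bool" where
  "connected_graph G \<longleftrightarrow>
    (\<forall>x\<in>verts G. \<forall>y\<in>verts G. (x, y) \<in> {(a, b). {a, b} \<in> edges G}\<^sup>*)"

definition graph_iso :: "'v graph \<Rightarrow> 'w graph \<Rightarrow> bool" where
  "graph_iso G H \<longleftrightarrow>
    (\<exists>f. bij_betw f (verts G) (verts H) \<and>
      (\<forall>x\<in>verts G. \<forall>y\<in>verts G. {x, y} \<in> edges G \<longleftrightarrow> {f x, f y} \<in> edges H))"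

record ('v, 'e) mgraph =
  mverts :: "'v set"
  medges :: "'e set"
  ends :: "'e \<Rightarrow> 'v set"

definition multi_graph :: "('v, 'e) mgraph \<Rightarrow> bool" where
  "multi_graph M \<longleftrightarrow> (\<forall>e\<in>medges M. ends M e \<in> [mverts M]\<^bsup>2\<^esup>)"

definition line_graph :: "('v, 'e) mgraph \<Rightarrow> 'e graph" where
  "line_graph M =
    \<lparr>verts = medges M,
     edges = {{e, f} | e f. e \<in> medges M \<and> f \<in> medges M \<and> card (ends M e \<inter> ends M f) = 1}\<rparr>"

definition mgraph_of :: "'v graph \<Rightarrow> ('v, 'v set) mgraph" where
  "mgraph_of G = \<lparr>mverts = verts G, medges = edges G, ends = (\<lambda>e. e)\<rparr>"

text \<open>HOL cannot quantify existentially over types, so the next two definitions place the root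
  graph on the type of pairs of a vertex and a Boolean. This is no restriction: only ends of
  edges matter, and every edge has two of them. The lemmas
  \<open>line_graph_of_multi_graphI\<close> and \<open>line_graph_of_ordinary_graphI\<close> below show
  that a root graph over any other types gives the same notion.\<close>

definition is_line_graph_of_multi_graph :: "'a graph \<Rightarrow> bool" where
  "is_line_graph_of_multi_graph G \<longleftrightarrow>
    (\<exists>M :: ('a \<times> bool, 'a) mgraph. multi_graph M \<and> graph_iso G (line_graph M))"

definition is_line_graph_of_ordinary_graph :: "'a graph \<Rightarrow> bool" where
  "is_line_graph_of_ordinary_graph G \<longleftrightarrow>
    (\<exists>H :: ('a \<times> bool) graph. ordinary_graph H \<and> graph_iso G (line_graph (mgraph_of H)))"

section \<open>Partial linear spaces\<close>

record 'p pls =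
  points :: "'p set"
  lines :: "'p set set"

definition pls_iso :: "'p pls \<Rightarrow> 'q pls \<Rightarrow> bool" where
  "pls_iso L K \<longleftrightarrow>
    (\<exists>f. bij_betw f (points L) (points K) \<and> (\<lambda>l. f ` l) ` lines L = lines K)"

definition pls_subspace :: "'p pls \<Rightarrow> 'p set \<Rightarrow> bool" where
  "pls_subspace L S \<longleftrightarrow> S \<subseteq> points L \<and>
    (\<forall>l\<in>lines L. (\<exists>a\<in>l \<inter> S. \<exists>b\<in>l \<inter> S. a \<noteq> b) \<longrightarrow> l \<subseteq> S)"

definition pls_restrict :: "'p pls \<Rightarrow> 'p set \<Rightarrow> 'p pls" where
  "pls_restrict L S = \<lparr>points = S, lines = {l \<in> lines L. l \<subseteq> S}\<rparr>"

definition pls_image :: "('p \<Rightarrow> 'q) \<Rightarrow> 'p pls \<Rightarrow> 'q pls" where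
  "pls_image f L = \<lparr>points = f ` points L, lines = (\<lambda>l. f ` l) ` lines L\<rparr>"

definition cotriangular_space :: "'o set \<Rightarrow> 'o set pls" where
  "cotriangular_space \<Omega> =
    \<lparr>points = [\<Omega>]\<^bsup>2\<^esup>,
     lines = {{{a, b}, {a, c}, {b, c}} | a b c.
       a \<in> \<Omega> \<and> b \<in> \<Omega> \<and> c \<in> \<Omega> \<and> a \<noteq> b \<and> a \<noteq> c \<and> b \<noteq> c}\<rparr>"

text \<open>As for root graphs, the type chosen for the set is no restriction; see
  \<open>cotriangular_space_of_setI\<close> below.\<close>

definition is_cotriangular_space_of_set :: "'p pls \<Rightarrow> bool" where
  "is_cotriangular_space_of_set L \<longleftrightarrow>
    (\<exists>\<Omega> :: ('p \<times> bool) set. pls_iso L (cotriangular_space \<Omega>))"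

section \<open>Orthogonal spaces over the field with two elements\<close>

text \<open>A vector space over the two-element field is given by its underlying group (written
  multiplicatively in HOL-Algebra), which determines the scalar multiplication.\<close>

definition orthogonal_cotriangular_space ::
    "('v, 'm) monoid_scheme \<Rightarrow> ('v \<Rightarrow> bit) \<Rightarrow> 'v pls" where
  "orthogonal_cotriangular_space V Q =
    \<lparr>points = {v \<in> carrier V. Q v = 1},
     lines = {{a, b, a \<otimes>\<^bsub>V\<^esub> b} | a b.
       a \<in> carrier V \<and> b \<in> carrier V \<and> Q a = 1 \<and> Q b = 1 \<and> Q (a \<otimes>\<^bsub>V\<^esub> b) = 1 \<and>
       a \<noteq> b \<and> a \<otimes>\<^bsub>V\<^esub> b \<noteq> a \<and> a \<otimes>\<^bsub>V\<^esub> b \<noteq> b}\<rparr>"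

definition isotropic_radical :: "('v, 'm) monoid_scheme \<Rightarrow> ('v \<Rightarrow> bit) \<Rightarrow> 'v set" where
  "isotropic_radical V Q =
    {v \<in> carrier V. Q v = 0 \<and> (\<forall>w\<in>carrier V. Q (v \<otimes>\<^bsub>V\<^esub> w) = Q w)}"

text \<open>The form induced on the quotient by the isotropic radical: \<^term>\<open>Q\<close> is constant on each
  coset.\<close>

definition induced_form :: "('v \<Rightarrow> bit) \<Rightarrow> 'v set \<Rightarrow> bit" where
  "induced_form Q C = the_elem (Q ` C)"

lemma induced_form_coset:
  assumes "monoid V" "Q \<one>\<^bsub>V\<^esub> = 0" "v \<in> carrier V"
  shows "induced_form Q (isotropic_radical V Q #>\<^bsub>V\<^esub> v) = Q v"
proof -
  have "\<one>\<^bsub>V\<^esub> \<in> isotropic_radical V Q"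
    using assms by (auto simp: isotropic_radical_def monoid.l_one monoid.one_closed)
  moreover have "Q (h \<otimes>\<^bsub>V\<^esub> v) = Q v" if "h \<in> isotropic_radical V Q" for h
    using that assms(3) by (simp add: isotropic_radical_def)
  ultimately have "Q ` (isotropic_radical V Q #>\<^bsub>V\<^esub> v) = {Q v}"
    unfolding r_coset_def image_UN by auto
  then show ?thesis by (simp add: induced_form_def)
qed

section \<open>The orthogonal space and the cotriangular space of a graph\<close>

definition graph_space :: "'a graph \<Rightarrow> 'a set monoid" where
  "graph_space G = \<lparr>carrier = Fpow (verts G), monoid.mult = sym_diff, one = {}\<rparr>"

lemma graph_space_comm_group: "comm_group (graph_space G)"
proof (rule comm_groupI)
  fix x assume "x \<in> carrier (graph_space G)"
  then show "\<exists>y\<in>carrier (graph_space G). y \<otimes>\<^bsub>graph_space G\<^esub> x = \<one>\<^bsub>graph_space G\<^esub>"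
    by (intro bexI[of _ x]) (auto simp: graph_space_def)
qed (auto simp: graph_space_def Fpow_def)

text \<open>The relation \<open>r\<close> is the strict total order on the vertices.\<close>

definition graph_bilinear :: "'a graph \<Rightarrow> ('a \<times> 'a) set \<Rightarrow> 'a set \<Rightarrow> 'a set \<Rightarrow> bit" where
  "graph_bilinear G r u w =
    of_nat (card {(x, y). x \<in> u \<and> y \<in> w \<and> (x = y \<or> (x, y) \<in> r \<and> {x, y} \<in> edges G)})"

definition graph_form :: "'a graph \<Rightarrow> ('a \<times> 'a) set \<Rightarrow> 'a set \<Rightarrow> bit" where
  "graph_form G r u = graph_bilinear G r u u"

definition Pi_space :: "'a graph \<Rightarrow> ('a \<times> 'a) set \<Rightarrow> 'a set pls" where
  "Pi_space G r =
    (let L = orthogonal_cotriangular_space (graph_space G) (graph_form G r)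
     in pls_restrict L (pls_subspace L hull ((\<lambda>v. {v}) ` verts G)))"

definition graph_radical :: "'a graph \<Rightarrow> ('a \<times> 'a) set \<Rightarrow> 'a set set" where
  "graph_radical G r = isotropic_radical (graph_space G) (graph_form G r)"

definition proj_radical :: "'a graph \<Rightarrow> ('a \<times> 'a) set \<Rightarrow> 'a set \<Rightarrow> 'a set set" where
  "proj_radical G r u = graph_radical G r #>\<^bsub>graph_space G\<^esub> u"

definition Pi_bar :: "'a graph \<Rightarrow> ('a \<times> 'a) set \<Rightarrow> 'a set set pls" where
  "Pi_bar G r = pls_image (proj_radical G r) (Pi_space G r)"

definition graph_bar :: "'a graph \<Rightarrow> ('a \<times> 'a) set \<Rightarrow> 'a set set graph" where
  "graph_bar G r =
    (let W = (\<lambda>v. proj_radical G r {v}) ` verts G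
     in \<lparr>verts = W,
         edges = {{a, b} | a b. a \<in> W \<and> b \<in> W \<and> a \<noteq> b \<and>
           induced_form (graph_form G r) (a \<otimes>\<^bsub>graph_space G Mod graph_radical G r\<^esub> b) = 1}\<rparr>)"

definition D4_graph :: "nat graph" where
  "D4_graph = \<lparr>verts = {0, 1, 2, 3}, edges = {{0, 1}, {0, 2}, {0, 3}}\<rparr>"

definition Pi_D4 :: "nat set pls" where
  "Pi_D4 = Pi_space D4_graph less_than"

section \<open>Independence of the chosen types\<close>

lemma ends_embedding:
  fixes h :: "'i \<Rightarrow> 'v set"
  assumes "\<And>i. i \<in> I \<Longrightarrow> card (h i) = 2"
  obtains \<phi> :: "'v \<Rightarrow> 'i \<times> bool" where "inj_on \<phi> (\<Union> (h ` I))"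
proof -
  have "\<exists>p. \<forall>i\<in>I. h i = {p i True, p i False}"
  proof -
    have "\<forall>i\<in>I. \<exists>q :: bool \<Rightarrow> 'v. h i = {q True, q False}"
    proof
      fix i assume "i \<in> I"
      then obtain a b where "h i = {a, b}" using assms card_2_iff by metis
      then show "\<exists>q :: bool \<Rightarrow> 'v. h i = {q True, q False}"
        by (intro exI[of _ "\<lambda>t. if t then a else b"]) simp
    qed
    then show ?thesis by (rule bchoice)
  qed
  then obtain p where p: "\<And>i. i \<in> I \<Longrightarrow> h i = {p i True, p i False}" by blast
  have "\<Union> (h ` I) \<subseteq> (\<lambda>(i, t). p i t) ` (I \<times> UNIV)"
  proof
    fix x assume "x \<in> \<Union> (h ` I)"
    then obtain i where i: "i \<in> I" "x = p i True \<or> x = p i False" using p by auto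
    then obtain t where "x = p i t" by blast
    with i(1) show "x \<in> (\<lambda>(i, t). p i t) ` (I \<times> UNIV)"
      by (intro image_eqI[of _ _ "(i, t)"]) auto
  qed
  then have "inj_on (inv_into (I \<times> UNIV) (\<lambda>(i, t). p i t)) (\<Union> (h ` I))"
    by (rule inj_on_inv_into)
  then show ?thesis by (rule that)
qed

lemma nsets2_image:
  assumes "inj_on \<phi> A" "e \<in> [A]\<^bsup>2\<^esup>"
  shows "\<phi> ` e \<in> [\<phi> ` A]\<^bsup>2\<^esup>"
proof -
  have "inj_on \<phi> e" using assms by (auto simp: nsets_def intro: inj_on_subset)
  then show ?thesis using assms(2) by (auto simp: nsets_def card_image)
qed

lemma line_graph_edge_iff:
  "{e, f} \<in> edges (line_graph M) \<longleftrightarrow>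
    e \<in> medges M \<and> f \<in> medges M \<and> card (ends M e \<inter> ends M f) = 1"
  by (auto simp: line_graph_def doubleton_eq_iff Int_commute)

lemma card_image_Int:
  assumes "inj_on \<phi> U" "A \<subseteq> U" "B \<subseteq> U"
  shows "card (\<phi> ` A \<inter> \<phi> ` B) = card (A \<inter> B)"
proof -
  have "\<phi> ` A \<inter> \<phi> ` B = \<phi> ` (A \<inter> B)" using inj_on_image_Int[OF assms] by simp
  moreover have "inj_on \<phi> (A \<inter> B)" by (rule inj_on_subset[OF assms(1)]) (use assms in auto)
  ultimately show ?thesis by (simp add: card_image)
qed

lemma line_graph_of_multi_graphI:
  fixes M :: "('v, 'e) mgraph" and G :: "'a graph"
  assumes M: "multi_graph M" and iso: "graph_iso G (line_graph M)"
  shows "is_line_graph_of_multi_graph G"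
proof -
  obtain f where f: "bij_betw f (verts G) (medges M)"
    and adj: "\<And>x y. x \<in> verts G \<Longrightarrow> y \<in> verts G \<Longrightarrow>
      {x, y} \<in> edges G \<longleftrightarrow> {f x, f y} \<in> edges (line_graph M)"
    using iso by (auto simp: graph_iso_def line_graph_def)
  have fm: "f x \<in> medges M" if "x \<in> verts G" for x
    using f that by (auto simp: bij_betw_def)
  let ?U = "\<Union> ((\<lambda>x. ends M (f x)) ` verts G)"
  have E: "ends M (f x) \<in> [?U]\<^bsup>2\<^esup>" if "x \<in> verts G" for x
    using M fm that by (auto simp: multi_graph_def nsets_def)
  obtain \<phi> :: "'v \<Rightarrow> 'a \<times> bool" where \<phi>: "inj_on \<phi> ?U"
    using ends_embedding[of "verts G" "\<lambda>x. ends M (f x)"] E by (auto simp: nsets_def)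
  define N where "N = \<lparr>mverts = \<phi> ` ?U, medges = verts G, ends = (\<lambda>x. \<phi> ` ends M (f x))\<rparr>"
  have "multi_graph N"
    using nsets2_image[OF \<phi> E] by (auto simp: multi_graph_def N_def)
  moreover have "graph_iso G (line_graph N)"
    unfolding graph_iso_def
  proof (intro exI[of _ "\<lambda>x. x"] conjI ballI)
    show "bij_betw (\<lambda>x. x) (verts G) (verts (line_graph N))"
      by (simp add: line_graph_def N_def bij_betw_def)
  next
    fix x y assume xy: "x \<in> verts G" "y \<in> verts G"
    have "card (\<phi> ` ends M (f x) \<inter> \<phi> ` ends M (f y)) = card (ends M (f x) \<inter> ends M (f y))"
      by (rule card_image_Int[OF \<phi>]) (use xy in auto)
    then show "{x, y} \<in> edges G \<longleftrightarrow> {x, y} \<in> edges (line_graph N)"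
      using xy fm by (simp add: adj line_graph_edge_iff N_def)
  qed
  ultimately show ?thesis unfolding is_line_graph_of_multi_graph_def by blast
qed

lemma line_graph_of_ordinary_graphI:
  fixes H :: "'v graph" and G :: "'a graph"
  assumes H: "ordinary_graph H" and iso: "graph_iso G (line_graph (mgraph_of H))"
  shows "is_line_graph_of_ordinary_graph G"
proof -
  obtain f where f: "bij_betw f (verts G) (edges H)"
    and adj: "\<And>x y. x \<in> verts G \<Longrightarrow> y \<in> verts G \<Longrightarrow>
      {x, y} \<in> edges G \<longleftrightarrow> {f x, f y} \<in> edges (line_graph (mgraph_of H))"
    using iso by (auto simp: graph_iso_def line_graph_def mgraph_of_def)
  have fm: "f x \<in> edges H" if "x \<in> verts G" for x
    using f that by (auto simp: bij_betw_def)
  let ?U = "\<Union> (f ` verts G)"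
  have E: "f x \<in> [?U]\<^bsup>2\<^esup>" if "x \<in> verts G" for x
    using H fm that by (auto simp: ordinary_graph_def nsets_def)
  obtain \<phi> :: "'v \<Rightarrow> 'a \<times> bool" where \<phi>: "inj_on \<phi> ?U"
    using ends_embedding[of "verts G" f] E by (auto simp: nsets_def)
  define N where "N = \<lparr>verts = \<phi> ` ?U, edges = (\<lambda>x. \<phi> ` f x) ` verts G\<rparr>"
  have "ordinary_graph N"
    using nsets2_image[OF \<phi> E] by (auto simp: ordinary_graph_def N_def)
  moreover have "graph_iso G (line_graph (mgraph_of N))"
    unfolding graph_iso_def
  proof (intro exI[of _ "\<lambda>x. \<phi> ` f x"] conjI ballI)
    have "inj_on (\<lambda>x. \<phi> ` f x) (verts G)"
    proof (rule inj_onI)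
      fix x y assume xy: "x \<in> verts G" "y \<in> verts G" "\<phi> ` f x = \<phi> ` f y"
      have "f x = f y"
        by (rule inj_on_image_eq_iff[THEN iffD1, OF \<phi> _ _ xy(3)]) (use xy in auto)
      then show "x = y" using f xy by (auto simp: bij_betw_def inj_on_def)
    qed
    then show "bij_betw (\<lambda>x. \<phi> ` f x) (verts G) (verts (line_graph (mgraph_of N)))"
      by (simp add: line_graph_def mgraph_of_def N_def bij_betw_def)
  next
    fix x y assume xy: "x \<in> verts G" "y \<in> verts G"
    have "card (\<phi> ` f x \<inter> \<phi> ` f y) = card (f x \<inter> f y)"
      by (rule card_image_Int[OF \<phi>]) (use xy in auto)
    then show "{x, y} \<in> edges G \<longleftrightarrow> {\<phi> ` f x, \<phi> ` f y} \<in> edges (line_graph (mgraph_of N))"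
      using xy fm by (simp add: adj line_graph_edge_iff N_def mgraph_of_def)
  qed
  ultimately show ?thesis unfolding is_line_graph_of_ordinary_graph_def by blast
qed

lemma cotriangular_space_of_setI:
  fixes \<Omega> :: "'o set" and L :: "'p pls"
  assumes iso: "pls_iso L (cotriangular_space \<Omega>)"
  shows "is_cotriangular_space_of_set L"
proof -
  obtain f where f: "bij_betw f (points L) ([\<Omega>]\<^bsup>2\<^esup>)"
    and fl: "(\<lambda>l. f ` l) ` lines L = lines (cotriangular_space \<Omega>)"
    using iso by (auto simp: pls_iso_def cotriangular_space_def)
  have fi: "f ` points L = [\<Omega>]\<^bsup>2\<^esup>" using f by (simp add: bij_betw_def)
  let ?U = "\<Union> (f ` points L)"
  have c2: "card (f x) = 2" if "x \<in> points L" for x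
    using fi that by (auto simp: nsets_def)
  obtain \<phi> :: "'o \<Rightarrow> 'p \<times> bool" where \<phi>: "inj_on \<phi> ?U"
    using ends_embedding[of "points L" f] c2 by auto
  have U: "?U \<subseteq> \<Omega>" unfolding fi by (auto simp: nsets_def)
  have pair: "a \<in> ?U" "b \<in> ?U" if "a \<in> \<Omega>" "b \<in> \<Omega>" "a \<noteq> b" for a b
  proof -
    have "{a, b} \<in> [\<Omega>]\<^bsup>2\<^esup>" using that by (auto simp: nsets_def)
    then show "a \<in> ?U" "b \<in> ?U" unfolding fi by blast+
  qed
  have N: "[\<Omega>]\<^bsup>2\<^esup> = [?U]\<^bsup>2\<^esup>"
    using U unfolding fi by (auto simp: nsets_def)
  have P: "(`) \<phi> ` [?U]\<^bsup>2\<^esup> = [\<phi> ` ?U]\<^bsup>2\<^esup>"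
  proof
    show "(`) \<phi> ` [?U]\<^bsup>2\<^esup> \<subseteq> [\<phi> ` ?U]\<^bsup>2\<^esup>" using nsets2_image[OF \<phi>] by auto
    show "[\<phi> ` ?U]\<^bsup>2\<^esup> \<subseteq> (`) \<phi> ` [?U]\<^bsup>2\<^esup>"
    proof
      fix e assume e: "e \<in> [\<phi> ` ?U]\<^bsup>2\<^esup>"
      then obtain d where d: "d \<subseteq> ?U" "e = \<phi> ` d" unfolding nsets_def subset_image_iff by blast
      have "inj_on \<phi> d" by (rule inj_on_subset[OF \<phi> d(1)])
      then have "d \<in> [?U]\<^bsup>2\<^esup>" using e d by (simp add: nsets_def card_image finite_image_iff)
      then show "e \<in> (`) \<phi> ` [?U]\<^bsup>2\<^esup>" using d by blast
    qed
  qed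
  have inj2: "inj_on ((`) \<phi>) ([?U]\<^bsup>2\<^esup>)"
    by (rule inj_on_subset[OF inj_on_image_Pow[OF \<phi>]]) (auto simp: nsets_def)
  have "bij_betw ((`) \<phi> \<circ> f) (points L) ([\<phi> ` ?U]\<^bsup>2\<^esup>)"
    by (rule bij_betw_trans[OF f]) (use inj2 P N in \<open>simp add: bij_betw_def\<close>)
  moreover have "(\<lambda>l. ((`) \<phi> \<circ> f) ` l) ` lines L = lines (cotriangular_space (\<phi> ` ?U))"
  proof -
    have "(\<lambda>l. ((`) \<phi> \<circ> f) ` l) ` lines L = (\<lambda>l. ((`) \<phi>) ` l) ` lines (cotriangular_space \<Omega>)"
      unfolding fl[symmetric] by (simp add: image_image image_comp)
    also have "\<dots> = lines (cotriangular_space (\<phi> ` ?U))"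
    proof (intro equalityI subsetI)
      fix l assume "l \<in> (\<lambda>l. ((`) \<phi>) ` l) ` lines (cotriangular_space \<Omega>)"
      then obtain a b c where abc: "a \<in> \<Omega>" "b \<in> \<Omega>" "c \<in> \<Omega>" "a \<noteq> b" "a \<noteq> c" "b \<noteq> c"
        and l: "l = {{\<phi> a, \<phi> b}, {\<phi> a, \<phi> c}, {\<phi> b, \<phi> c}}"
        by (auto simp: cotriangular_space_def)
      have m: "a \<in> ?U" "b \<in> ?U" "c \<in> ?U" using pair abc by blast+
      have "\<phi> a \<noteq> \<phi> b" "\<phi> a \<noteq> \<phi> c" "\<phi> b \<noteq> \<phi> c"
        using abc m inj_onD[OF \<phi>] by blast+
      with l m show "l \<in> lines (cotriangular_space (\<phi> ` ?U))"
        unfolding cotriangular_space_def by (simp only: pls.simps mem_Collect_eq) blast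
    next
      fix l assume "l \<in> lines (cotriangular_space (\<phi> ` ?U))"
      then obtain a b c where m: "a \<in> ?U" "b \<in> ?U" "c \<in> ?U"
        and ne: "\<phi> a \<noteq> \<phi> b" "\<phi> a \<noteq> \<phi> c" "\<phi> b \<noteq> \<phi> c"
        and l: "l = {{\<phi> a, \<phi> b}, {\<phi> a, \<phi> c}, {\<phi> b, \<phi> c}}"
        unfolding cotriangular_space_def by (simp only: pls.simps mem_Collect_eq) blast
      have "a \<in> \<Omega>" "b \<in> \<Omega>" "c \<in> \<Omega>" using m U by blast+
      then have "{{a, b}, {a, c}, {b, c}} \<in> lines (cotriangular_space \<Omega>)"
        unfolding cotriangular_space_def using ne by (simp only: pls.simps mem_Collect_eq) blast
      then show "l \<in> (\<lambda>l. ((`) \<phi>) ` l) ` lines (cotriangular_space \<Omega>)"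
        by (rule rev_image_eqI) (simp add: l)
    qed
    finally show ?thesis .
  qed
  ultimately have "pls_iso L (cotriangular_space (\<phi> ` ?U))"
    unfolding pls_iso_def by (intro exI[of _ "(`) \<phi> \<circ> f"]) (simp add: cotriangular_space_def)
  then show ?thesis unfolding is_cotriangular_space_of_set_def by blast
qed

end

theory Submission
  imports Defs
begin

text \<open>
  Points of \<open>\<Pi>\<close> are collinear iff the polar form of \<open>Q\<close> is 1 on them, and two points agree
  modulo the isotropic radical iff they are orthogonal to the same vertices. The equivalences are
  obtained around the cycle (i), (iv), (iii), (ii), (i).

  A subspace \<open>\<Pi>\<^sub>D\<^sub>4\<close> of \<open>\<Pi>bar\<close> is the same as a claw: a point collinear with three distinct,
  pairwise non-collinear points. Indeed a claw is an isometric image of the graph \<open>D\<^sub>4\<close>, and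
  the distinctness makes the induced map injective on points.

  If \<open>\<Gamma>\<close> is a line graph, sending each vertex to its pair of ends extends to a linear isometry
  under which every point of \<open>\<Pi>\<close> becomes a 2-set. Of three 2-sets meeting \<open>{x, y}\<close> in one
  element, two share \<open>x\<close> or \<open>y\<close>, so if they are not collinear they coincide: there is no claw.

  Without claws, take collinear points \<open>a, b\<close> and let \<open>X\<close> consist of \<open>a, b\<close> and all points
  other than \<open>a + b\<close> collinear with both. Any two points of \<open>X\<close> are collinear, since otherwise
  \<open>a\<close> with these two and \<open>a + b\<close> would be a claw. By connectedness every point is a sum of two
  elements of \<open>\<Omega> = X \<union> {0}\<close>, and \<open>{x, y} \<mapsto> x + y\<close> is the isomorphism from the cotriangular
  space of \<open>\<Omega>\<close>.

  Finally (iii) identifies the vertices of \<open>\<Gamma>bar\<close> with 2-sets, which are the edges of the root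
  graph, and repeating each of them once for every vertex of \<open>\<Gamma>\<close> above it gives (i).
\<close>

section \<open>Forms on spaces of finite sets\<close>

lemma image_setcompr2: "f ` {g a b | a b. \<phi> a b} = {f (g a b) | a b. \<phi> a b}"
  by blast

lemma odd_card_sym_diff:
  assumes "finite A" "finite B"
  shows "odd (card (sym_diff A B)) \<longleftrightarrow> odd (card A) \<noteq> odd (card B)"
proof -
  have "card A = card (A - B) + card (A \<inter> B)" "card B = card (B - A) + card (A \<inter> B)"
    using card_Int_Diff[OF assms(1), of B] card_Int_Diff[OF assms(2), of A]
    by (simp_all add: Int_commute)
  moreover have "card (sym_diff A B) = card (A - B) + card (B - A)"
    using assms by (intro card_Un_disjoint) auto
  ultimately show ?thesis by auto
qed

lemma Fpow_sym_diff: "u \<in> Fpow X \<Longrightarrow> w \<in> Fpow X \<Longrightarrow> sym_diff u w \<in> Fpow X"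
  by (auto simp: Fpow_def)

text \<open>Truth values stand for the two-element field, with \<open>\<noteq>\<close> as addition;
  the condition is then linearity on the space of finite subsets of \<open>X\<close>.\<close>

definition additive_on :: "'a set \<Rightarrow> ('a set \<Rightarrow> bool) \<Rightarrow> bool" where
  "additive_on X f \<longleftrightarrow> (\<forall>u\<in>Fpow X. \<forall>w\<in>Fpow X. f (sym_diff u w) \<longleftrightarrow> f u \<noteq> f w)"

definition biadditive_on :: "'a set \<Rightarrow> ('a set \<Rightarrow> 'a set \<Rightarrow> bool) \<Rightarrow> bool" where
  "biadditive_on X b \<longleftrightarrow>
    (\<forall>w\<in>Fpow X. additive_on X (b w)) \<and> (\<forall>w\<in>Fpow X. additive_on X (\<lambda>u. b u w))"

text \<open>The singletons are a basis of \<open>Fpow X\<close>: inserting a new element into a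
  finite set adds its singleton. In the empty case, \<open>{}\<close> is the sum of itself with
  itself, which makes both functions False there.\<close>

lemma additive_on_unique:
  assumes f: "additive_on X f" "additive_on X f'"
    and eq: "\<And>x. x \<in> X \<Longrightarrow> f {x} = f' {x}" and u: "u \<in> Fpow X"
  shows "f u = f' u"
proof -
  have "finite u" "u \<subseteq> X" using u by (auto simp: Fpow_def)
  then show ?thesis
  proof (induction u rule: finite_induct)
    case empty
    have "{} \<in> Fpow X" by (simp add: Fpow_def)
    then show ?case using f unfolding additive_on_def by (metis Diff_cancel Un_absorb)
  next
    case (insert x u)
    then have "insert x u = sym_diff {x} u" "{x} \<in> Fpow X" "u \<in> Fpow X"
      by (auto simp: Fpow_def)
    then show ?case using f eq insert unfolding additive_on_def by (metis insert_subset)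
  qed
qed

text \<open>Reduces identities between bilinear forms to pairs of vertices. Symmetry of the polar
  form, polarisation and the isometries below are all obtained through it.\<close>

lemma biadditive_on_unique:
  assumes b: "biadditive_on X b" "biadditive_on X b'"
    and eq: "\<And>x y. x \<in> X \<Longrightarrow> y \<in> X \<Longrightarrow> b {x} {y} = b' {x} {y}"
    and uw: "u \<in> Fpow X" "w \<in> Fpow X"
  shows "b u w = b' u w"
proof -
  have sing: "{x} \<in> Fpow X" if "x \<in> X" for x using that by (auto simp: Fpow_def)
  have bw: "additive_on X (b v)" "additive_on X (\<lambda>u. b u v)"
      "additive_on X (b' v)" "additive_on X (\<lambda>u. b' u v)" if "v \<in> Fpow X" for v
    using b that unfolding biadditive_on_def by blast+
  have "b {x} w = b' {x} w" if "x \<in> X" for x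
    using additive_on_unique[OF bw(1,3)[OF sing[OF that]] eq[OF that] uw(2)] .
  then show ?thesis
    using additive_on_unique[OF bw(2,4)[OF uw(2)] _ uw(1)] by blast
qed

text \<open>The linear extension of \<open>h\<close>: the sum modulo 2 of the sets
  \<open>h v\<close> over \<open>v\<close> in a finite set \<open>u\<close>.\<close>

definition sym_diff_sum :: "('a \<Rightarrow> 'b set) \<Rightarrow> 'a set \<Rightarrow> 'b set" where
  "sym_diff_sum h u = {x. odd (card {v \<in> u. x \<in> h v})}"

lemma sym_diff_sum_singleton [simp]: "sym_diff_sum h {v} = h v"
proof -
  have "{w \<in> {v}. x \<in> h w} = (if x \<in> h v then {v} else {})" for x by auto
  then show ?thesis by (auto simp: sym_diff_sum_def)
qed

lemma sym_diff_sum_sym_diff: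
  assumes "finite u" "finite w"
  shows "sym_diff_sum h (sym_diff u w) = sym_diff (sym_diff_sum h u) (sym_diff_sum h w)"
proof -
  have "{v \<in> sym_diff u w. x \<in> h v} = sym_diff {v \<in> u. x \<in> h v} {v \<in> w. x \<in> h v}" for x
    by auto
  then have "x \<in> sym_diff_sum h (sym_diff u w) \<longleftrightarrow>
      x \<in> sym_diff (sym_diff_sum h u) (sym_diff_sum h w)" for x
    using assms odd_card_sym_diff[of "{v \<in> u. x \<in> h v}" "{v \<in> w. x \<in> h v}"]
    by (simp add: sym_diff_sum_def) blast
  then show ?thesis by blast
qed

lemma sym_diff_sum_subset: "sym_diff_sum h u \<subseteq> \<Union> (h ` u)"
proof
  fix x assume "x \<in> sym_diff_sum h u"
  then have "{v \<in> u. x \<in> h v} \<noteq> {}" unfolding sym_diff_sum_def by (auto simp del: Collect_empty_eq)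
  then show "x \<in> \<Union> (h ` u)" by auto
qed

text \<open>Parity of the intersection is the standard bilinear form on finite sets, here pulled
  back along a linear map. Finite \<open>h v\<close> keep all sums finite, so that parity is
  additive.\<close>

lemma biadditive_on_sym_diff_sum:
  assumes "\<And>v. v \<in> X \<Longrightarrow> finite (h v)"
  shows "biadditive_on X (\<lambda>u w. odd (card (sym_diff_sum h u \<inter> sym_diff_sum h w)))"
proof -
  have fin: "finite (sym_diff_sum h u)" if "u \<in> Fpow X" for u
    by (rule finite_subset[OF sym_diff_sum_subset]) (use that assms in \<open>auto simp: Fpow_def\<close>)
  have Int: "sym_diff A B \<inter> C = sym_diff (A \<inter> C) (B \<inter> C)"
    "C \<inter> sym_diff A B = sym_diff (C \<inter> A) (C \<inter> B)" for A B C :: "'b set" by auto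
  show ?thesis
    unfolding biadditive_on_def additive_on_def
  proof (intro conjI ballI)
    fix w u v assume w: "w \<in> Fpow X" "u \<in> Fpow X" "v \<in> Fpow X"
    then have *: "sym_diff_sum h (sym_diff u v) = sym_diff (sym_diff_sum h u) (sym_diff_sum h v)"
      by (intro sym_diff_sum_sym_diff) (auto simp: Fpow_def)
    show "odd (card (sym_diff_sum h w \<inter> sym_diff_sum h (sym_diff u v))) =
       (odd (card (sym_diff_sum h w \<inter> sym_diff_sum h u)) \<noteq>
        odd (card (sym_diff_sum h w \<inter> sym_diff_sum h v)))"
      unfolding * Int by (rule odd_card_sym_diff) (use fin w in auto)
    show "odd (card (sym_diff_sum h (sym_diff u v) \<inter> sym_diff_sum h w)) =
       (odd (card (sym_diff_sum h u \<inter> sym_diff_sum h w)) \<noteq>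
        odd (card (sym_diff_sum h v \<inter> sym_diff_sum h w)))"
      unfolding * Int by (rule odd_card_sym_diff) (use fin w in auto)
  qed
qed

section \<open>Partial linear spaces\<close>

lemma pls_subspaceD:
  assumes "pls_subspace K S" "l \<in> lines K" "a \<in> l" "b \<in> l" "a \<in> S" "b \<in> S" "a \<noteq> b"
  shows "l \<subseteq> S"
  using assms unfolding pls_subspace_def by blast

text \<open>The inverse of \<open>f\<close> is controlled only on points; it undoes \<open>f\<close>
  on a line because lines consist of points.\<close>

lemma pls_iso_sym:
  assumes "pls_iso L K" and sub: "\<And>l. l \<in> lines L \<Longrightarrow> l \<subseteq> points L"
  shows "pls_iso K L"
proof -
  obtain f where f: "bij_betw f (points L) (points K)" "(\<lambda>l. f ` l) ` lines L = lines K"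
    using assms(1) by (auto simp: pls_iso_def)
  let ?g = "inv_into (points L) f"
  have "?g ` (f ` l) = l" if "l \<in> lines L" for l
    using f(1) sub[OF that] by (simp add: bij_betw_def inv_into_image_cancel)
  then have "(\<lambda>l. ?g ` l) ` lines K = lines L"
    unfolding f(2)[symmetric] image_image by simp
  then show ?thesis
    unfolding pls_iso_def using bij_betw_inv_into[OF f(1)] by blast
qed

lemma pls_iso_trans:
  assumes "pls_iso L K" "pls_iso K M"
  shows "pls_iso L M"
proof -
  obtain f where f: "bij_betw f (points L) (points K)" "(\<lambda>l. f ` l) ` lines L = lines K"
    using assms(1) by (auto simp: pls_iso_def)
  obtain g where g: "bij_betw g (points K) (points M)" "(\<lambda>l. g ` l) ` lines K = lines M"
    using assms(2) by (auto simp: pls_iso_def)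
  have "(\<lambda>l. (g \<circ> f) ` l) ` lines L = lines M"
    unfolding g(2)[symmetric] f(2)[symmetric] by (simp add: image_image image_comp)
  then show ?thesis
    unfolding pls_iso_def using bij_betw_trans[OF f(1) g(1)] by blast
qed

lemma two_subsets_cases:
  assumes "e \<in> [\<Omega>]\<^bsup>2\<^esup>" "f \<in> [\<Omega>]\<^bsup>2\<^esup>"
  obtains (eq) "e = f"
  | (share) x y z where "e = {x, y}" "f = {x, z}" "x \<in> \<Omega>" "y \<in> \<Omega>" "z \<in> \<Omega>" "x \<noteq> y" "x \<noteq> z" "y \<noteq> z"
  | (disj) x y z w where "e = {x, y}" "f = {z, w}" "x \<in> \<Omega>" "y \<in> \<Omega>" "z \<in> \<Omega>" "w \<in> \<Omega>"
      "x \<noteq> y" "z \<noteq> w" "x \<noteq> z" "x \<noteq> w" "y \<noteq> z" "y \<noteq> w"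
proof -
  obtain x y where e: "e = {x, y}" "x \<noteq> y" "x \<in> \<Omega>" "y \<in> \<Omega>"
    using assms(1) by (auto elim: nsets2_E)
  obtain z w where f: "f = {z, w}" "z \<noteq> w" "z \<in> \<Omega>" "w \<in> \<Omega>"
    using assms(2) by (auto elim: nsets2_E)
  have swap: "{a, b} = {b, a}" for a b :: 'a by auto
  show thesis
  proof (cases "x = z \<or> x = w \<or> y = z \<or> y = w")
    case True
    then show thesis
      using e f eq share[of x y w] share[of x y z] share[of y x w] share[of y x z] swap
      by (elim disjE) (metis (no_types))+
  next
    case False
    then show thesis using e f disj by blast
  qed
qed

section \<open>Claw-free cotriangular spaces\<close>

text \<open>An opaque constant: \<open>sym_diff\<close> is an abbreviation, which automation unfolds.\<close>

definition sdiff :: "'a set \<Rightarrow> 'a set \<Rightarrow> 'a set" (infixl "\<triangle>" 65) where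
  "a \<triangle> b = sym_diff a b"

lemma sdiff_assoc: "(a \<triangle> b) \<triangle> c = a \<triangle> (b \<triangle> c)"
  and sdiff_commute: "a \<triangle> b = b \<triangle> a"
  and sdiff_left_commute: "a \<triangle> (b \<triangle> c) = b \<triangle> (a \<triangle> c)"
  and sdiff_self [simp]: "a \<triangle> a = {}"
  and sdiff_self_left [simp]: "a \<triangle> (a \<triangle> b) = b"
  and sdiff_empty [simp]: "a \<triangle> {} = a" "{} \<triangle> a = a"
  and sdiff_left_cancel [simp]: "a \<triangle> b = a \<triangle> c \<longleftrightarrow> b = c"
  by (auto simp: sdiff_def)

lemmas sdiff_ac = sdiff_assoc sdiff_commute sdiff_left_commute

text \<open>An alternating bilinear form on a space of sets over the two-element field, with truth
  values as scalars.\<close>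

locale alternating_space =
  fixes V :: "'v set set" and adj :: "'v set \<Rightarrow> 'v set \<Rightarrow> bool"
  assumes zero_closed: "{} \<in> V"
    and adj_self: "u \<in> V \<Longrightarrow> \<not> adj u u"
    and adj_sym: "u \<in> V \<Longrightarrow> w \<in> V \<Longrightarrow> adj u w \<longleftrightarrow> adj w u"
    and adj_add: "u \<in> V \<Longrightarrow> v \<in> V \<Longrightarrow> w \<in> V \<Longrightarrow> adj (u \<triangle> v) w \<longleftrightarrow> adj u w \<noteq> adj v w"
    and closed: "u \<in> V \<Longrightarrow> w \<in> V \<Longrightarrow> u \<triangle> w \<in> V"
begin

lemma adj_add2:
  "u \<in> V \<Longrightarrow> v \<in> V \<Longrightarrow> w \<in> V \<Longrightarrow> adj w (u \<triangle> v) \<longleftrightarrow> adj w u \<noteq> adj w v"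
  using adj_add[of u v w] adj_sym[of w] closed[of u v] by blast

lemma adj_zero: "u \<in> V \<Longrightarrow> \<not> adj {} u" "u \<in> V \<Longrightarrow> \<not> adj u {}"
  using adj_add[of u u u] adj_self adj_add2[of u u u] by auto

text \<open>With 0 adjoined to the clique, \<open>x \<triangle> y\<close> behaves like the pair
  \<open>{x, y}\<close>: sums of pairs sharing one element are adjacent, sums of disjoint pairs are
  orthogonal. Two disjoint pairs could have equal sums only if 0 were among the four elements, and
  \<open>noline\<close> excludes this.\<close>

lemma pls_iso_cotriangular_of_clique:
  assumes X: "X \<subseteq> V" "{} \<notin> X"
    and clique: "\<And>x y. x \<in> X \<Longrightarrow> y \<in> X \<Longrightarrow> x \<noteq> y \<Longrightarrow> adj x y"
    and noline: "\<And>x y z. x \<in> X \<Longrightarrow> y \<in> X \<Longrightarrow> z \<in> X \<Longrightarrow> x \<noteq> y \<Longrightarrow> x \<noteq> z \<Longrightarrow> y \<noteq> z \<Longrightarrow> x \<triangle> y \<noteq> z"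
    and P: "P = X \<union> {x \<triangle> y | x y. x \<in> X \<and> y \<in> X \<and> x \<noteq> y}"
  shows "pls_iso \<lparr>points = P, lines = {{a, b, a \<triangle> b} | a b. a \<in> P \<and> b \<in> P \<and> adj a b}\<rparr>
    (cotriangular_space (insert {} X))"
proof (rule pls_iso_sym)
  let ?O = "insert {} X"
  \<comment> \<open>On a pair, union minus intersection is the symmetric difference, so the map is
    defined without ordering the pair.\<close>
  let ?g = "\<lambda>e. \<Union>e - \<Inter>e :: 'v set"
  have g: "?g {x, y} = x \<triangle> y" for x y by (auto simp: sdiff_def)
  have OV: "x \<in> V" if "x \<in> ?O" for x using that X zero_closed by auto
  have mem: "x \<triangle> y \<in> P" if "x \<in> ?O" "y \<in> ?O" "x \<noteq> y" for x y
    using that P by auto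
  have adjO: "adj x y \<longleftrightarrow> x \<noteq> y \<and> x \<noteq> {} \<and> y \<noteq> {}" if "x \<in> ?O" "y \<in> ?O" for x y
    using that clique[of x y] adj_zero adj_self[of x] OV by auto
  have shared: "adj (x \<triangle> y) (x \<triangle> z)"
    if "x \<in> ?O" "y \<in> ?O" "z \<in> ?O" "x \<noteq> y" "x \<noteq> z" "y \<noteq> z" for x y z
  proof -
    have "adj (x \<triangle> y) (x \<triangle> z) \<longleftrightarrow> (adj x x \<noteq> adj x z) \<noteq> (adj y x \<noteq> adj y z)"
      using that(1-3)[THEN OV] by (auto simp: adj_add adj_add2 closed)
    then show ?thesis using that adjO by auto
  qed
  have disjoint: "\<not> adj (x \<triangle> y) (z \<triangle> w)" "x \<triangle> y \<noteq> z \<triangle> w"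
    if O: "x \<in> ?O" "y \<in> ?O" "z \<in> ?O" "w \<in> ?O"
      and ne: "x \<noteq> y" "z \<noteq> w" "x \<noteq> z" "x \<noteq> w" "y \<noteq> z" "y \<noteq> w" for x y z w
  proof -
    have "adj (x \<triangle> y) (z \<triangle> w) \<longleftrightarrow> (adj x z \<noteq> adj x w) \<noteq> (adj y z \<noteq> adj y w)"
      using O[THEN OV] by (auto simp: adj_add adj_add2 closed)
    then show "\<not> adj (x \<triangle> y) (z \<triangle> w)" using O ne adjO by auto
    show "x \<triangle> y \<noteq> z \<triangle> w"
    proof
      assume eq: "x \<triangle> y = z \<triangle> w"
      \<comment> \<open>If one of the four is 0, the equation makes a member of the clique the sum
        of two others, against \<open>noline\<close>. Otherwise both sides are paired with
        \<open>x\<close>: the left gives 1, the right 1 + 1.\<close>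
      consider "x = {}" | "y = {}" | "z = {}" | "w = {}"
        | "x \<in> X" "y \<in> X" "z \<in> X" "w \<in> X" using O by auto
      then show False
      proof cases
        case 1 then show ?thesis using noline[of z w y] eq O ne by auto
      next
        case 2 then show ?thesis using noline[of z w x] eq O ne by auto
      next
        case 3 then show ?thesis using noline[of x y w] eq O ne by auto
      next
        case 4 then show ?thesis using noline[of x y z] eq O ne by auto
      next
        case 5
        have "adj x (x \<triangle> y) \<longleftrightarrow> adj x (z \<triangle> w)" using eq by simp
        then show False using 5 ne clique OV O adj_self by (simp add: adj_add2)
      qed
    qed
  qed
  have surj: "\<exists>e\<in>[?O]\<^bsup>2\<^esup>. p = ?g e" if p: "p \<in> P" for p
  proof -
    consider "p \<in> X" | x y where "p = x \<triangle> y" "x \<in> X" "y \<in> X" "x \<noteq> y" using p P by auto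
    then obtain x y where "p = x \<triangle> y" "x \<in> ?O" "y \<in> ?O" "x \<noteq> y"
    proof cases
      case 1 then show ?thesis using that[of "{}" p] X by auto
    next
      case 2 then show ?thesis using that[of x y] by blast
    qed
    then show ?thesis by (intro bexI[of _ "{x, y}"]) (simp only: g, simp)
  qed
  have inj: "inj_on ?g ([?O]\<^bsup>2\<^esup>)"
  proof (rule inj_onI)
    fix e f assume ef: "e \<in> [?O]\<^bsup>2\<^esup>" "f \<in> [?O]\<^bsup>2\<^esup>" "?g e = ?g f"
    from ef(1,2) show "e = f"
    proof (cases rule: two_subsets_cases)
      case (share x y z)
      then show ?thesis using ef(3) by (simp only: g sdiff_left_cancel)
    next
      case (disj x y z w)
      then have "x \<triangle> y = z \<triangle> w" using ef(3) by (simp only: g)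
      then show ?thesis using disjoint(2)[OF disj(3-12)] by simp
    qed
  qed
  have "?g ` [?O]\<^bsup>2\<^esup> = P"
  proof (intro equalityI subsetI)
    fix p assume "p \<in> ?g ` [?O]\<^bsup>2\<^esup>"
    then obtain e where e: "e \<in> [?O]\<^bsup>2\<^esup>" "p = ?g e" by (elim imageE)
    from e(1) obtain x y where xy: "e = {x, y}" "x \<in> ?O" "y \<in> ?O" "x \<noteq> y" by (rule nsets2_E)
    show "p \<in> P" unfolding e(2) xy(1) g by (rule mem[OF xy(2-4)])
  next
    fix p assume "p \<in> P"
    then show "p \<in> ?g ` [?O]\<^bsup>2\<^esup>" using surj by (simp only: image_iff)
  qed
  then have bij: "bij_betw ?g ([?O]\<^bsup>2\<^esup>) P" using inj by (simp add: bij_betw_def)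
  have lines: "(\<lambda>l. ?g ` l) ` lines (cotriangular_space ?O) =
      {{a, b, a \<triangle> b} | a b. a \<in> P \<and> b \<in> P \<and> adj a b}"
  proof (intro equalityI subsetI)
    fix l assume "l \<in> (\<lambda>l. ?g ` l) ` lines (cotriangular_space ?O)"
    then obtain x y z where O: "x \<in> ?O" "y \<in> ?O" "z \<in> ?O"
      and ne: "x \<noteq> y" "x \<noteq> z" "y \<noteq> z" and l: "l = ?g ` {{x, y}, {x, z}, {y, z}}"
      unfolding cotriangular_space_def pls.simps by blast
    \<comment> \<open>As \<open>x\<close> cancels, the third pair is sent to the sum of the other
      two images.\<close>
    have l': "l = {x \<triangle> y, x \<triangle> z, (x \<triangle> y) \<triangle> (x \<triangle> z)}"
      unfolding l image_insert image_empty g by (simp add: sdiff_ac)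
    show "l \<in> {{a, b, a \<triangle> b} | a b. a \<in> P \<and> b \<in> P \<and> adj a b}"
      by (intro CollectI exI[of _ "x \<triangle> y"] exI[of _ "x \<triangle> z"] conjI l' mem shared O ne)
  next
    fix l assume "l \<in> {{a, b, a \<triangle> b} | a b. a \<in> P \<and> b \<in> P \<and> adj a b}"
    then obtain a b where ab: "a \<in> P" "b \<in> P" "adj a b" "l = {a, b, a \<triangle> b}" by blast
    obtain e where e: "e \<in> [?O]\<^bsup>2\<^esup>" "a = ?g e" using surj[OF ab(1)] by blast
    obtain f where f: "f \<in> [?O]\<^bsup>2\<^esup>" "b = ?g f" using surj[OF ab(2)] by blast
    from e(1) f(1) show "l \<in> (\<lambda>l. ?g ` l) ` lines (cotriangular_space ?O)"
    proof (cases rule: two_subsets_cases)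
      case eq
      have "a \<in> V" using ab(1) P X closed by auto
      then show ?thesis using eq e f ab adj_self by simp
    next
      case (share x y z)
      have "a = x \<triangle> y" "b = x \<triangle> z" using e(2) f(2) share(1,2) by (simp_all only: g)
      then have "l = ?g ` {{x, y}, {x, z}, {y, z}}"
        unfolding image_insert image_empty g ab(4) by (simp add: sdiff_ac)
      moreover have "{{x, y}, {x, z}, {y, z}} \<in> lines (cotriangular_space ?O)"
        unfolding cotriangular_space_def pls.simps using share(3-) by blast
      ultimately show ?thesis by (rule image_eqI)
    next
      case (disj x y z w)
      then have "a = x \<triangle> y" "b = z \<triangle> w" using e f by (simp_all only: g)
      then show ?thesis using ab(3) disj(3-) disjoint(1)[of x y z w] by simp
    qed
  qed
  show "pls_iso (cotriangular_space ?O)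
      \<lparr>points = P, lines = {{a, b, a \<triangle> b} | a b. a \<in> P \<and> b \<in> P \<and> adj a b}\<rparr>"
    unfolding pls_iso_def pls.simps
    by (intro exI[of _ ?g] conjI lines) (use bij in \<open>simp add: cotriangular_space_def\<close>)
  fix l assume "l \<in> lines (cotriangular_space ?O)"
  then show "l \<subseteq> points (cotriangular_space ?O)"
    by (auto simp: cotriangular_space_def)
qed

text \<open>\<open>conn\<close> is connectedness as an induction principle. It is applied to
  \<open>?P\<close>, the clique \<open>X\<close> with its pairwise sums: neighbours of
  \<open>X\<close> stay in \<open>?P\<close> by \<open>nb\<close>, and a neighbour of a sum is a
  neighbour of a summand.\<close>

lemma claw_free_cotriangular:
  assumes P: "P \<subseteq> V" "{} \<notin> P"
    and ab: "a \<in> P" "b \<in> P" "adj a b"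
    and sum: "\<And>a b. a \<in> P \<Longrightarrow> b \<in> P \<Longrightarrow> adj a b \<Longrightarrow> a \<triangle> b \<in> P"
    and conn: "\<And>S. S \<subseteq> P \<Longrightarrow> S \<noteq> {} \<Longrightarrow> (\<And>p q. p \<in> S \<Longrightarrow> q \<in> P \<Longrightarrow> adj p q \<Longrightarrow> q \<in> S) \<Longrightarrow> S = P"
    and claw: "\<And>a b c d. a \<in> P \<Longrightarrow> b \<in> P \<Longrightarrow> c \<in> P \<Longrightarrow> d \<in> P \<Longrightarrow>
      adj a b \<Longrightarrow> adj a c \<Longrightarrow> adj a d \<Longrightarrow> \<not> adj b c \<Longrightarrow> \<not> adj b d \<Longrightarrow> \<not> adj c d \<Longrightarrow>
      b = c \<or> b = d \<or> c = d"
  shows "is_cotriangular_space_of_set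
    \<lparr>points = P, lines = {{a, b, a \<triangle> b} | a b. a \<in> P \<and> b \<in> P \<and> adj a b}\<rparr>"
proof -
  have V: "p \<in> V" if "p \<in> P" for p using that P by blast
  \<comment> \<open>In a cotriangular space of a set: the 2-sets containing the common element of \<open>a\<close> and \<open>b\<close>.\<close>
  define X where "X = {a, b} \<union> {c \<in> P. adj a c \<and> adj b c \<and> c \<noteq> a \<triangle> b}"
  have XP: "X \<subseteq> P" using ab by (auto simp: X_def)
  have ba: "adj b a" using ab adj_sym V by blast
  have clique: "adj x y" if xy: "x \<in> X" "y \<in> X" "x \<noteq> y" for x y
  proof (rule ccontr)
    assume n: "\<not> adj x y"
    have "adj x a" "adj x b" if "x \<in> X" "x \<noteq> a" "x \<noteq> b" for x
      using that ab adj_sym V by (auto simp: X_def)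
    with n xy ab ba have ne: "x \<noteq> a" "x \<noteq> b" "y \<noteq> a" "y \<noteq> b"
      by (auto simp: X_def)
    with xy have x: "x \<in> P" "adj a x" "adj b x" "x \<noteq> a \<triangle> b"
      and y: "y \<in> P" "adj a y" "adj b y" "y \<noteq> a \<triangle> b"
      by (auto simp: X_def)
    \<comment> \<open>Each of \<open>x\<close>, \<open>y\<close> is adjacent to both
      \<open>a\<close> and \<open>b\<close>, hence orthogonal to their sum, the third leaf of the
      claw with centre \<open>a\<close>.\<close>
    have "adj a (a \<triangle> b)" "\<not> adj (a \<triangle> b) x" "\<not> adj (a \<triangle> b) y"
      using ab x y V adj_self by (auto simp: adj_add adj_add2)
    then show False
      using claw[of a "a \<triangle> b" x y] sum[OF ab] ab x y n xy(3) by auto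
  qed
  have noline: "x \<triangle> y \<noteq> z"
    if "x \<in> X" "y \<in> X" "z \<in> X" "x \<noteq> y" "x \<noteq> z" "y \<noteq> z" for x y z
  proof
    assume z: "x \<triangle> y = z"
    \<comment> \<open>A further \<open>w\<close> in the clique would have polar value 1 with
      \<open>z\<close>, yet 1 + 1 with \<open>x \<triangle> y\<close>. So \<open>X\<close> is just
      this line, and its point other than \<open>a\<close> and \<open>b\<close> is
      \<open>a \<triangle> b\<close>, which the definition of \<open>X\<close> excludes.\<close>
    have "w \<in> {x, y, z}" if w: "w \<in> X" for w
    proof (rule ccontr)
      assume "w \<notin> {x, y, z}"
      then have "adj w x" "adj w y" "adj w z"
        using clique[OF w] \<open>x \<in> X\<close> \<open>y \<in> X\<close> \<open>z \<in> X\<close> by auto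
      moreover have "adj w z \<longleftrightarrow> adj w x \<noteq> adj w y"
        unfolding z[symmetric] using XP V w \<open>x \<in> X\<close> \<open>y \<in> X\<close> by (intro adj_add2) auto
      ultimately show False by simp
    qed
    then have "a \<in> {x, y, z}" "b \<in> {x, y, z}" by (simp_all add: X_def)
    moreover have "a \<noteq> b" using ab adj_self V by blast
    ultimately consider "a = x" "b = y" | "a = y" "b = x" | "a = x" "b = z" | "a = z" "b = x"
      | "a = y" "b = z" | "a = z" "b = y" by auto
    moreover have eqs: "x \<triangle> y = z" "y \<triangle> x = z" "x \<triangle> z = y" "z \<triangle> x = y" "y \<triangle> z = x" "z \<triangle> y = x"
      using z by (auto simp: sdiff_ac)
    have notab: "c \<noteq> a \<triangle> b" if "c \<in> X" "c \<noteq> a" "c \<noteq> b" for c using that by (auto simp: X_def)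
    ultimately show False
      by cases (use notab[of x] notab[of y] notab[of z] eqs that in simp_all)
  qed
  let ?P = "X \<union> {x \<triangle> y | x y. x \<in> X \<and> y \<in> X \<and> x \<noteq> y}"
  have both: "q \<in> X \<or> q = a \<triangle> b" if "q \<in> P" "adj a q" "adj b q" for q
    using that by (auto simp: X_def)
  have aX: "a \<in> X" "b \<in> X" "a \<noteq> b" using ab adj_self V by (auto simp: X_def)
  have sumP: "x \<triangle> y \<in> ?P" if "x \<in> X" "y \<in> X" "x \<noteq> y" for x y using that by blast
  \<comment> \<open>Here and in the next two facts, outside the cases already settled,
    \<open>q\<close> is shifted by an adjacent member of the clique to a common neighbour of
    \<open>a\<close> and \<open>b\<close>. By \<open>both\<close> this is in \<open>X\<close> or
    equals \<open>a \<triangle> b\<close>, and shifting back locates \<open>q\<close>.\<close>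
  have one: "q \<in> ?P" if q: "q \<in> P" "adj a q" for q
  proof (cases "adj b q")
    case True
    then show ?thesis using both[OF q] sumP[OF aX] by blast
  next
    case False
    have "adj a (a \<triangle> q)" "adj b (a \<triangle> q)"
      using False q ab ba V adj_self by (auto simp: adj_add2)
    then consider "a \<triangle> q \<in> X" | "a \<triangle> q = a \<triangle> b" using both sum[OF ab(1) q] by blast
    then show ?thesis
    proof cases
      case 1
      have "a \<noteq> a \<triangle> q" using q P by (metis sdiff_empty(1) sdiff_left_cancel)
      from sumP[OF aX(1) 1 this] show ?thesis by simp
    next
      case 2 then show ?thesis using aX by simp
    qed
  qed
  have two: "q \<in> ?P" if q: "q \<in> P" "adj b q" for q
  proof (cases "adj a q")
    case True then show ?thesis using one q by blast
  next
    case False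
    have "adj b (b \<triangle> q)" "adj a (b \<triangle> q)"
      using False q ab ba V adj_self by (auto simp: adj_add2)
    then consider "b \<triangle> q \<in> X" | "b \<triangle> q = a \<triangle> b" using both sum[OF ab(2) q] by blast
    then show ?thesis
    proof cases
      case 1
      have "b \<noteq> b \<triangle> q" using q P by (metis sdiff_empty(1) sdiff_left_cancel)
      from sumP[OF aX(2) 1 this] show ?thesis by simp
    next
      case 2
      then have "q = a" by (simp add: sdiff_commute[of a])
      then show ?thesis using aX by simp
    qed
  qed
  have nb: "q \<in> ?P" if q: "q \<in> P" and x: "x \<in> X" "adj x q" for q x
  proof (cases "adj a q \<or> adj b q \<or> x = a \<or> x = b")
    case True
    then show ?thesis using one two q x by blast
  next
    case False
    then have x': "x \<in> P" "adj a x" "adj b x" using x by (auto simp: X_def)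
    have "adj a (x \<triangle> q)" "adj b (x \<triangle> q)"
      using False q ab x' V by (auto simp: adj_add2)
    then consider "x \<triangle> q \<in> X" | "x \<triangle> q = a \<triangle> b" using both sum[OF x'(1) q x(2)] by blast
    then show ?thesis
    proof cases
      case 1
      have "x \<noteq> x \<triangle> q" using q P by (metis sdiff_empty(1) sdiff_left_cancel)
      from sumP[OF x(1) 1 this] show ?thesis by simp
    next
      case 2
      \<comment> \<open>This case is impossible: \<open>x\<close> pairs to 1 with
        \<open>x \<triangle> q\<close> and to 1 + 1 with \<open>a \<triangle> b\<close>.\<close>
      have "adj (x \<triangle> q) x" using x x' q V adj_self adj_sym by (auto simp: adj_add)
      moreover have "\<not> adj (a \<triangle> b) x" using x' ab V by (auto simp: adj_add)
      ultimately show ?thesis using 2 by simp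
    qed
  qed
  have "?P = P"
  proof (rule conn)
    show "?P \<subseteq> P" using XP sum clique by blast
    show "?P \<noteq> {}" using aX by blast
    fix p q assume "p \<in> ?P" and q: "q \<in> P" "adj p q"
    then consider "p \<in> X" | x y where "p = x \<triangle> y" "x \<in> X" "y \<in> X" by blast
    then obtain x where "x \<in> X" "adj x q"
    proof cases
      case 1 then show ?thesis using that q by blast
    next
      case 2
      then have "adj x q \<or> adj y q" using q XP V adj_add[of x y q] by blast
      then show ?thesis using that 2 by blast
    qed
    then show "q \<in> ?P" using nb q by blast
  qed
  show ?thesis
    by (rule cotriangular_space_of_setI, rule pls_iso_cotriangular_of_clique[of X])
      (use XP P clique noline \<open>?P = P\<close> in \<open>auto\<close>)
qed

end

section \<open>Collinearity: isomorphisms, subspaces, spaces of 2-sets\<close>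

definition collinear :: "'p pls \<Rightarrow> 'p \<Rightarrow> 'p \<Rightarrow> bool" where
  "collinear K p q \<longleftrightarrow> p \<noteq> q \<and> (\<exists>l\<in>lines K. p \<in> l \<and> q \<in> l)"

lemma collinear_iso:
  assumes f: "bij_betw f (points K) (points M)" "(\<lambda>l. f ` l) ` lines K = lines M"
    and sub: "\<And>l. l \<in> lines K \<Longrightarrow> l \<subseteq> points K"
    and pq: "p \<in> points K" "q \<in> points K"
  shows "collinear M (f p) (f q) \<longleftrightarrow> collinear K p q"
proof -
  have inj: "inj_on f (points K)" using f by (simp add: bij_betw_def)
  have "f x \<in> f ` l \<longleftrightarrow> x \<in> l" if "l \<in> lines K" "x \<in> points K" for l x
    using inj_on_image_mem_iff[OF inj that(2) sub[OF that(1)]] .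
  then show ?thesis
    unfolding collinear_def f(2)[symmetric] using pq inj_on_eq_iff[OF inj pq] by auto
qed

lemma collinear_restrict:
  assumes "pls_subspace K S" "p \<in> S" "q \<in> S"
  shows "collinear (pls_restrict K S) p q \<longleftrightarrow> collinear K p q"
proof -
  have "l \<subseteq> S" if "l \<in> lines K" "p \<in> l" "q \<in> l" "p \<noteq> q" for l
    using pls_subspaceD[OF assms(1) that(1-3) assms(2,3) that(4)] .
  then show ?thesis unfolding collinear_def pls_restrict_def by auto
qed

text \<open>The sides of a triangle pairwise share one corner, and two 2-sets with one common
  element are sides of a triangle. This is how lines of 2-sets become adjacency in a line
  graph.\<close>

lemma collinear_cotriangular_space:
  assumes ef: "e \<in> [\<Omega>]\<^bsup>2\<^esup>" "f \<in> [\<Omega>]\<^bsup>2\<^esup>"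
  shows "collinear (cotriangular_space \<Omega>) e f \<longleftrightarrow> card (e \<inter> f) = 1"
proof
  assume "collinear (cotriangular_space \<Omega>) e f"
  then obtain a b c where "a \<noteq> b" "a \<noteq> c" "b \<noteq> c" "e \<noteq> f"
    "e \<in> {{a, b}, {a, c}, {b, c}}" "f \<in> {{a, b}, {a, c}, {b, c}}"
    unfolding collinear_def cotriangular_space_def pls.simps by blast
  then have "e \<inter> f = {a} \<or> e \<inter> f = {b} \<or> e \<inter> f = {c}" by auto
  then show "card (e \<inter> f) = 1" by auto
next
  assume c: "card (e \<inter> f) = 1"
  from ef show "collinear (cotriangular_space \<Omega>) e f"
  proof (cases rule: two_subsets_cases)
    case eq
    then show ?thesis using c ef by (simp add: nsets_def)
  next
    case (share x y z)
    then have "{{x, y}, {x, z}, {y, z}} \<in> lines (cotriangular_space \<Omega>)"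
      unfolding cotriangular_space_def pls.simps by blast
    moreover have "e \<noteq> f" using share by (auto simp: doubleton_eq_iff)
    ultimately show ?thesis unfolding collinear_def
      by (intro conjI bexI[of _ "{{x, y}, {x, z}, {y, z}}"]) (simp_all add: share(1,2))
  next
    case (disj x y z w)
    then have "e \<inter> f = {}" by auto
    then show ?thesis using c by simp
  qed
qed

section \<open>The orthogonal space of a graph\<close>

locale ordered_graph =
  fixes G :: "'a graph" and r :: "('a \<times> 'a) set"
  assumes ordinary: "ordinary_graph G"
    and order: "strict_linear_order_on (verts G) r"
begin

abbreviation V where "V \<equiv> Fpow (verts G)"

text \<open>The vertices that are not orthogonal to a given vector.\<close>

definition nbhd :: "'a set \<Rightarrow> 'a set" where
  "nbhd = sym_diff_sum (\<lambda>v. {x. {v, x} \<in> edges G})"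

text \<open>The polar form of \<^term>\<open>graph_form G r\<close>.\<close>

definition adj :: "'a set \<Rightarrow> 'a set \<Rightarrow> bool" where
  "adj u w \<longleftrightarrow> odd (card (w \<inter> nbhd u))"

lemma edgeD: "{x, y} \<in> edges G \<Longrightarrow> x \<in> verts G \<and> y \<in> verts G \<and> x \<noteq> y"
  using ordinary by (auto simp: ordinary_graph_def nsets_def)

lemma singleton_V: "v \<in> verts G \<Longrightarrow> {v} \<in> V"
  by (simp add: Fpow_def)

lemma nbhd_sym_diff: "u \<in> V \<Longrightarrow> w \<in> V \<Longrightarrow> nbhd (sym_diff u w) = sym_diff (nbhd u) (nbhd w)"
  unfolding nbhd_def by (rule sym_diff_sum_sym_diff) (auto simp: Fpow_def)

lemma nbhd_subset: "nbhd u \<subseteq> verts G"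
  using sym_diff_sum_subset edgeD unfolding nbhd_def by fastforce

lemma adj_singleton_right: "adj u {x} \<longleftrightarrow> x \<in> nbhd u"
  by (cases "x \<in> nbhd u") (simp_all add: adj_def)

lemma adj_singletons: "adj {x} {y} \<longleftrightarrow> {x, y} \<in> edges G"
  by (simp add: adj_singleton_right nbhd_def)

text \<open>Neighbourhoods may be infinite, but they are counted only inside a finite vector, where
  parity is additive.\<close>

lemma biadditive_adj: "biadditive_on (verts G) adj"
  unfolding biadditive_on_def additive_on_def
proof (intro conjI ballI)
  fix w u v assume w: "w \<in> V" "u \<in> V" "v \<in> V"
  then have fin: "finite w" "finite u" "finite v" by (auto simp: Fpow_def)
  have "sym_diff u v \<inter> nbhd w = sym_diff (u \<inter> nbhd w) (v \<inter> nbhd w)" by auto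
  then show "adj w (sym_diff u v) = (adj w u \<noteq> adj w v)"
    unfolding adj_def using fin by (simp add: odd_card_sym_diff)
  have "w \<inter> nbhd (sym_diff u v) = sym_diff (w \<inter> nbhd u) (w \<inter> nbhd v)"
    using w by (auto simp: nbhd_sym_diff)
  then show "adj (sym_diff u v) w = (adj u w \<noteq> adj v w)"
    unfolding adj_def using fin by (simp add: odd_card_sym_diff)
qed

lemma adj_left: "u \<in> V \<Longrightarrow> v \<in> V \<Longrightarrow> w \<in> V \<Longrightarrow> adj (sym_diff u v) w \<longleftrightarrow> adj u w \<noteq> adj v w"
  using biadditive_adj by (simp add: biadditive_on_def additive_on_def)

text \<open>The definition treats its arguments differently, but by bilinearity it suffices to
  compare vertices, where edges are unordered.\<close>

lemma adj_sym:
  assumes "u \<in> V" "w \<in> V"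
  shows "adj u w \<longleftrightarrow> adj w u"
  by (rule biadditive_on_unique[of "verts G" adj "\<lambda>u w. adj w u"])
    (use assms biadditive_adj in \<open>auto simp: adj_singletons biadditive_on_def insert_commute\<close>)

definition form :: "'a set \<Rightarrow> bool" where
  "form u \<longleftrightarrow> graph_form G r u = 1"

text \<open>The order-dependent bilinear form whose diagonal is the quadratic form.\<close>

definition gram :: "'a set \<Rightarrow> 'a set \<Rightarrow> bool" where
  "gram u w \<longleftrightarrow> odd (card {(x, y) \<in> u \<times> w. x = y \<or> (x, y) \<in> r \<and> {x, y} \<in> edges G})"

lemma form_iff: "form u \<longleftrightarrow> gram u u"
proof -
  have "of_nat n = (1 :: bit) \<longleftrightarrow> odd n" for n by (induction n) auto
  moreover have "{(x, y). x \<in> u \<and> y \<in> u \<and> (x = y \<or> (x, y) \<in> r \<and> {x, y} \<in> edges G)} =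
      {(x, y) \<in> u \<times> u. x = y \<or> (x, y) \<in> r \<and> {x, y} \<in> edges G}" by auto
  ultimately show ?thesis
    unfolding form_def gram_def graph_form_def graph_bilinear_def by simp
qed

lemma biadditive_gram: "biadditive_on (verts G) gram"
  unfolding biadditive_on_def additive_on_def
proof (intro conjI ballI)
  let ?R = "\<lambda>x y. x = y \<or> (x, y) \<in> r \<and> {x, y} \<in> edges G"
  fix w u v assume w: "w \<in> V" "u \<in> V" "v \<in> V"
  have fin: "finite {(x, y) \<in> a \<times> b. ?R x y}" if "a \<in> V" "b \<in> V" for a b
    by (rule finite_subset[of _ "a \<times> b"]) (use that in \<open>auto simp: Fpow_def\<close>)
  have 1: "{(x, y) \<in> w \<times> sym_diff u v. ?R x y} =
      sym_diff {(x, y) \<in> w \<times> u. ?R x y} {(x, y) \<in> w \<times> v. ?R x y}" by auto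
  show "gram w (sym_diff u v) = (gram w u \<noteq> gram w v)"
    unfolding gram_def 1 by (rule odd_card_sym_diff) (use fin w in blast)+
  have 2: "{(x, y) \<in> sym_diff u v \<times> w. ?R x y} =
      sym_diff {(x, y) \<in> u \<times> w. ?R x y} {(x, y) \<in> v \<times> w. ?R x y}" by auto
  show "gram (sym_diff u v) w = (gram u w \<noteq> gram v w)"
    unfolding gram_def 2 by (rule odd_card_sym_diff) (use fin w in blast)+
qed

lemma gram_singletons: "gram {x} {y} \<longleftrightarrow> x = y \<or> (x, y) \<in> r \<and> {x, y} \<in> edges G"
proof -
  let ?R = "x = y \<or> (x, y) \<in> r \<and> {x, y} \<in> edges G"
  have "{(a, b) \<in> {x} \<times> {y}. a = b \<or> (a, b) \<in> r \<and> {a, b} \<in> edges G} =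
      (if ?R then {(x, y)} else {})" by auto
  then show ?thesis unfolding gram_def by auto
qed

text \<open>Diagonal terms cancel, and an edge is counted in exactly one direction because
  \<open>r\<close> is a strict linear order on the vertices.\<close>

lemma gram_swap:
  assumes "u \<in> V" "w \<in> V"
  shows "gram u w \<noteq> gram w u \<longleftrightarrow> adj u w"
proof (rule biadditive_on_unique[of "verts G" "\<lambda>u w. gram u w \<noteq> gram w u" adj])
  show "biadditive_on (verts G) (\<lambda>u w. gram u w \<noteq> gram w u)"
    using biadditive_gram by (auto simp: biadditive_on_def additive_on_def)
  fix x y assume xy: "x \<in> verts G" "y \<in> verts G"
  have "(x, y) \<in> r \<longleftrightarrow> (y, x) \<notin> r" if "x \<noteq> y"
    using order xy that
    by (auto simp: strict_linear_order_on_def total_on_def irrefl_def dest: transD)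
  then show "(gram {x} {y} \<noteq> gram {y} {x}) = adj {x} {y}"
    by (auto simp: gram_singletons adj_singletons insert_commute dest: edgeD)
qed (use assms biadditive_adj in auto)

text \<open>Expanding \<open>gram\<close> bilinearly on the sum leaves two cross terms, which add up
  to the polar form.\<close>

lemma form_sym_diff:
  assumes "u \<in> V" "w \<in> V"
  shows "form (sym_diff u w) \<longleftrightarrow> (form u \<noteq> form w) \<noteq> adj u w"
proof -
  have *: "gram (sym_diff u w) v \<longleftrightarrow> gram u v \<noteq> gram w v"
    "gram v (sym_diff u w) \<longleftrightarrow> gram v u \<noteq> gram v w" if "v \<in> V" for v
    using biadditive_gram assms that by (auto simp: biadditive_on_def additive_on_def)
  show ?thesis
    unfolding form_iff *(1)[OF Fpow_sym_diff[OF assms]] *(2)[OF assms(1)] *(2)[OF assms(2)]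
    using gram_swap[OF assms] by blast
qed

lemma form_singleton: "form {v}"
  by (simp add: form_iff gram_singletons)

lemma form_empty: "\<not> form {}"
  by (simp add: form_iff gram_def)

lemma adj_self: "u \<in> V \<Longrightarrow> \<not> adj u u"
  using gram_swap[of u u] by simp

lemma adj_right: "u \<in> V \<Longrightarrow> v \<in> V \<Longrightarrow> w \<in> V \<Longrightarrow> adj w (sym_diff u v) \<longleftrightarrow> adj w u \<noteq> adj w v"
  using biadditive_adj by (simp add: biadditive_on_def additive_on_def)

section \<open>The isotropic radical and the projection modulo it\<close>

abbreviation R where "R \<equiv> graph_radical G r"
abbreviation proj where "proj \<equiv> proj_radical G r"
abbreviation P where "P \<equiv> points (Pi_space G r)"

lemma form_eq_iff: "graph_form G r u = graph_form G r w \<longleftrightarrow> form u = form w"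
  by (cases "graph_form G r u"; cases "graph_form G r w") (simp_all add: form_def)

lemma graph_form_0_iff: "graph_form G r u = 0 \<longleftrightarrow> \<not> form u"
  by (cases "graph_form G r u") (simp_all add: form_def)

lemma graph_space_simps [simp]:
  "carrier (graph_space G) = V" "u \<otimes>\<^bsub>graph_space G\<^esub> w = sym_diff u w" "\<one>\<^bsub>graph_space G\<^esub> = {}"
  by (simp_all add: graph_space_def)

text \<open>A vertex in the neighbourhood is itself a vector not orthogonal to \<open>u\<close>.
  Thus the kernel of \<open>nbhd\<close> is the radical of the polar form.\<close>

lemma nbhd_empty_iff: "u \<in> V \<Longrightarrow> nbhd u = {} \<longleftrightarrow> (\<forall>w\<in>V. \<not> adj u w)"
proof
  assume *: "\<forall>w\<in>V. \<not> adj u w"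
  show "nbhd u = {}"
  proof (rule ccontr)
    assume "nbhd u \<noteq> {}"
    then obtain x where x: "x \<in> nbhd u" by blast
    then have "{x} \<in> V" using nbhd_subset singleton_V by blast
    then show False using * x adj_singleton_right by blast
  qed
qed (simp add: adj_def)

text \<open>When \<open>form u\<close> fails, translation by \<open>u\<close> preserves the form
  exactly if \<open>u\<close> is orthogonal to everything.\<close>

lemma radical_iff: "u \<in> R \<longleftrightarrow> u \<in> V \<and> \<not> form u \<and> nbhd u = {}"
proof -
  have "u \<in> R \<longleftrightarrow> u \<in> V \<and> \<not> form u \<and> (\<forall>w\<in>V. form (sym_diff u w) = form w)"
    by (simp add: graph_radical_def isotropic_radical_def form_eq_iff graph_form_0_iff)
  then show ?thesis using form_sym_diff[of u] nbhd_empty_iff[of u] by meson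
qed

lemma nbhd_eq_adj: "nbhd u = nbhd v \<Longrightarrow> adj u w = adj v w"
  by (simp add: adj_def)

lemma radical_sym_diff: "u \<in> R \<Longrightarrow> w \<in> R \<Longrightarrow> sym_diff u w \<in> R"
  unfolding radical_iff using form_sym_diff nbhd_sym_diff nbhd_empty_iff Fpow_sym_diff by auto

lemma empty_radical: "{} \<in> R"
  by (simp add: radical_iff form_empty Fpow_def nbhd_def sym_diff_sum_def)

lemma proj_def': "proj u = (\<lambda>h. sym_diff h u) ` R"
  by (auto simp: proj_radical_def r_coset_def)

lemma proj_eq_iff: "proj u = proj w \<longleftrightarrow> sym_diff u w \<in> R"
proof
  assume "proj u = proj w"
  moreover have "u \<in> proj u" unfolding proj_def' by (rule image_eqI[OF _ empty_radical]) auto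
  ultimately obtain h where "h \<in> R" "u = sym_diff h w" unfolding proj_def' by auto
  moreover from this have "sym_diff u w = h" by auto
  ultimately show "sym_diff u w \<in> R" by simp
next
  have *: "proj a \<subseteq> proj b" if "sym_diff a b \<in> R" for a b
  proof
    fix x assume "x \<in> proj a"
    then obtain h where h: "h \<in> R" "x = sym_diff h a" unfolding proj_def' by auto
    then have "x = sym_diff (sym_diff h (sym_diff a b)) b" by auto
    then show "x \<in> proj b" unfolding proj_def'
      using radical_sym_diff[OF h(1) that] by (rule image_eqI)
  qed
  assume "sym_diff u w \<in> R"
  then show "proj u = proj w"
    using *[of u w] *[of w u] by (simp add: Un_commute)
qed

text \<open>If the neighbourhoods agree, then \<open>adj u w = adj w w\<close> is false, so the sum
  of the two anisotropic vectors has form value 1 + 1 + 0: it is isotropic and lies in the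
  radical.\<close>

lemma proj_eq_anisotropic:
  assumes "u \<in> V" "w \<in> V" "form u" "form w"
  shows "proj u = proj w \<longleftrightarrow> nbhd u = nbhd w"
proof -
  have "adj u w = adj w w" if "nbhd u = nbhd w" using that by (rule nbhd_eq_adj)
  then show ?thesis
    using assms adj_self[of w] Fpow_sym_diff[of u _ w]
    by (auto simp: proj_eq_iff radical_iff form_sym_diff nbhd_sym_diff)
qed

section \<open>Elliptic lines and the space generated by the vertices\<close>

abbreviation L where "L \<equiv> orthogonal_cotriangular_space (graph_space G) (graph_form G r)"

lemma points_L: "points L = {u \<in> V. form u}"
  by (simp add: orthogonal_cotriangular_space_def form_def)

text \<open>The sum of two anisotropic vectors is anisotropic exactly when their polar value is 1.
  Distinctness follows, since the polar form is alternating and 0 is isotropic.\<close>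

lemma lines_L: "lines L = {{a, b, sym_diff a b} | a b.
    a \<in> V \<and> b \<in> V \<and> form a \<and> form b \<and> adj a b}"
proof -
  have "a \<in> V \<and> b \<in> V \<and> form a \<and> form b \<and> adj a b \<longleftrightarrow>
    a \<in> V \<and> b \<in> V \<and> form a \<and> form b \<and> form (sym_diff a b) \<and>
      a \<noteq> b \<and> sym_diff a b \<noteq> a \<and> sym_diff a b \<noteq> b" for a b
  proof -
    have "sym_diff a b = a \<longleftrightarrow> b = {}" "sym_diff a b = b \<longleftrightarrow> a = {}" by auto
    then show ?thesis using adj_self[of a] form_empty form_sym_diff[of a b] by auto
  qed
  then show ?thesis
    by (simp add: orthogonal_cotriangular_space_def flip: form_def)
qed

text \<open>Allows a line to be rewritten in terms of whichever two of its points are at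
  hand.\<close>

lemma elliptic_line:
  assumes "a \<in> V" "b \<in> V" "adj a b" "u \<in> {a, b, sym_diff a b}" "w \<in> {a, b, sym_diff a b}" "u \<noteq> w"
  shows "adj u w" "{u, w, sym_diff u w} = {a, b, sym_diff a b}"
proof -
  have adj: "adj b a" "adj a (sym_diff a b)" "adj b (sym_diff a b)"
      "adj (sym_diff a b) a" "adj (sym_diff a b) b"
    using assms adj_self by (auto simp: adj_left adj_right adj_sym[of b a])
  have eq: "sym_diff b a = sym_diff a b" "sym_diff a (sym_diff a b) = b"
      "sym_diff b (sym_diff a b) = a" "sym_diff (sym_diff a b) a = b"
      "sym_diff (sym_diff a b) b = a" by auto
  have cases: "u = a \<and> w = b \<or> u = b \<and> w = a \<or> u = a \<and> w = sym_diff a b \<or>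
      u = b \<and> w = sym_diff a b \<or> u = sym_diff a b \<and> w = a \<or> u = sym_diff a b \<and> w = b"
    using assms(4-6) by (elim insertE emptyE) simp_all
  then show "adj u w" using adj assms(3) by (elim disjE conjE) simp_all
  show "{u, w, sym_diff u w} = {a, b, sym_diff a b}"
    using cases by (elim disjE conjE) (simp_all only: eq insert_commute)
qed

lemma pls_subspace_L_iff: "pls_subspace L T \<longleftrightarrow>
    T \<subseteq> {u \<in> V. form u} \<and> (\<forall>a\<in>T. \<forall>b\<in>T. adj a b \<longrightarrow> sym_diff a b \<in> T)"
proof (intro iffI conjI ballI impI)
  assume T: "pls_subspace L T"
  then show sub: "T \<subseteq> {u \<in> V. form u}" by (simp add: pls_subspace_def points_L)
  fix a b assume ab: "a \<in> T" "b \<in> T" "adj a b"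
  then have "{a, b, sym_diff a b} \<in> lines L" using sub by (auto simp: lines_L)
  moreover have "a \<noteq> b" using ab sub adj_self by auto
  ultimately have "{a, b, sym_diff a b} \<subseteq> T"
    using ab by (intro pls_subspaceD[OF T, of _ a b]) auto
  then show "sym_diff a b \<in> T" by simp
next
  assume T: "T \<subseteq> {u \<in> V. form u} \<and> (\<forall>a\<in>T. \<forall>b\<in>T. adj a b \<longrightarrow> sym_diff a b \<in> T)"
  have "l \<subseteq> T" if "l \<in> lines L" "x \<in> l \<inter> T" "y \<in> l \<inter> T" "x \<noteq> y" for l x y
  proof -
    obtain a b where ab: "l = {a, b, sym_diff a b}" "a \<in> V" "b \<in> V" "adj a b"
      using \<open>l \<in> lines L\<close> by (auto simp: lines_L)
    have "{x, y, sym_diff x y} = l" "adj x y"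
      using elliptic_line[OF ab(2-4), of x y] that ab(1) by simp_all
    then show ?thesis using T that by auto
  qed
  then show "pls_subspace L T" using T unfolding pls_subspace_def points_L by blast
qed

lemma P_def: "P = pls_subspace L hull ((\<lambda>v. {v}) ` verts G)"
  by (simp add: Pi_space_def pls_restrict_def Let_def)

text \<open>The hull is the intersection of all subspaces containing the vertices. The set of all
  anisotropic vectors is one of them, and closure under sums passes to the intersection.\<close>

lemma P_subspace: "pls_subspace L P"
proof -
  let ?A = "(\<lambda>v. {v}) ` verts G"
  have whole: "pls_subspace L {u \<in> V. form u}" "?A \<subseteq> {u \<in> V. form u}"
    using form_sym_diff Fpow_sym_diff form_singleton singleton_V
    by (auto simp: pls_subspace_L_iff)
  then have "P \<subseteq> {u \<in> V. form u}" unfolding P_def by (intro hull_minimal)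
  moreover have "sym_diff a b \<in> P" if "a \<in> P" "b \<in> P" "adj a b" for a b
    using that unfolding P_def hull_def by (auto simp: pls_subspace_L_iff)
  ultimately show ?thesis by (simp add: pls_subspace_L_iff)
qed

lemma P_V: "p \<in> P \<Longrightarrow> p \<in> V" and P_form: "p \<in> P \<Longrightarrow> form p"
  and P_sym_diff: "p \<in> P \<Longrightarrow> q \<in> P \<Longrightarrow> adj p q \<Longrightarrow> sym_diff p q \<in> P"
  using P_subspace by (auto simp: pls_subspace_L_iff)

lemma P_singleton: "v \<in> verts G \<Longrightarrow> {v} \<in> P"
  unfolding P_def by (intro hull_inc) simp

text \<open>By closure under adjacent sums, the points satisfying \<open>\<phi>\<close> form a
  subspace containing the vertices, so minimality of the hull applies.\<close>

lemma P_induct [consumes 1, case_names vertex sum]: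
  assumes "p \<in> P"
    and vertex: "\<And>v. v \<in> verts G \<Longrightarrow> \<phi> {v}"
    and sum: "\<And>p q. p \<in> P \<Longrightarrow> q \<in> P \<Longrightarrow> adj p q \<Longrightarrow> \<phi> p \<Longrightarrow> \<phi> q \<Longrightarrow> \<phi> (sym_diff p q)"
  shows "\<phi> p"
proof -
  have "pls_subspace L {p \<in> P. \<phi> p}"
    using P_V P_form P_sym_diff sum by (auto simp: pls_subspace_L_iff)
  then have "P \<subseteq> {p \<in> P. \<phi> p}"
    using P_singleton vertex by (subst P_def, intro hull_minimal) auto
  then show ?thesis using assms(1) by blast
qed

lemma lines_Pi_space: "lines (Pi_space G r) =
    {{a, b, sym_diff a b} | a b. a \<in> P \<and> b \<in> P \<and> adj a b}"
proof -
  have "lines (Pi_space G r) = {l \<in> lines L. l \<subseteq> P}"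
    by (simp add: Pi_space_def pls_restrict_def Let_def)
  also have "\<dots> = {{a, b, sym_diff a b} | a b. a \<in> P \<and> b \<in> P \<and> adj a b}"
  proof (intro equalityI subsetI)
    fix l assume "l \<in> {l \<in> lines L. l \<subseteq> P}"
    then obtain a b where "l = {a, b, sym_diff a b}" "adj a b" "l \<subseteq> P"
      unfolding lines_L by auto
    then have ab: "a \<in> P" "b \<in> P" "adj a b" "l = {a, b, sym_diff a b}" by auto
    show "l \<in> {{a, b, sym_diff a b} | a b. a \<in> P \<and> b \<in> P \<and> adj a b}"
      by (intro CollectI exI[of _ a] exI[of _ b] conjI ab)
  next
    fix l assume "l \<in> {{a, b, sym_diff a b} | a b. a \<in> P \<and> b \<in> P \<and> adj a b}"
    then obtain a b where l: "l = {a, b, sym_diff a b}" and ab: "a \<in> P" "b \<in> P" "adj a b"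
      unfolding mem_Collect_eq by (elim exE conjE)
    have "l \<in> lines L" unfolding lines_L
      by (intro CollectI exI[of _ a] exI[of _ b] conjI ab l P_V P_form)
    moreover have "l \<subseteq> P" using P_sym_diff[OF ab] ab l by simp
    ultimately show "l \<in> {l \<in> lines L. l \<subseteq> P}" by simp
  qed
  finally show ?thesis .
qed

section \<open>The quotient space and the quotient graph\<close>

lemma points_Pi_bar: "points (Pi_bar G r) = proj ` P"
  by (simp add: Pi_bar_def pls_image_def)

lemma lines_Pi_bar: "lines (Pi_bar G r) =
    {{proj a, proj b, proj (sym_diff a b)} | a b. a \<in> P \<and> b \<in> P \<and> adj a b}"
proof -
  have "lines (Pi_bar G r) = (\<lambda>l. proj ` l) ` lines (Pi_space G r)"
    by (simp add: Pi_bar_def pls_image_def)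
  also have "\<dots> = {{proj a, proj b, proj (sym_diff a b)} | a b. a \<in> P \<and> b \<in> P \<and> adj a b}"
    unfolding lines_Pi_space image_setcompr2 image_insert image_empty ..
  finally show ?thesis .
qed

lemma proj_eq_P: "p \<in> P \<Longrightarrow> q \<in> P \<Longrightarrow> proj p = proj q \<longleftrightarrow> nbhd p = nbhd q"
  by (intro proj_eq_anisotropic P_V P_form)

lemma subgroup_radical: "subgroup R (graph_space G)"
proof -
  interpret comm_group "graph_space G" by (rule graph_space_comm_group)
  show ?thesis
  proof (rule subgroupI)
    show "R \<noteq> {}" using empty_radical by blast
    show "R \<subseteq> carrier (graph_space G)" by (auto simp: radical_iff)
    show "inv\<^bsub>graph_space G\<^esub> u \<in> R" if "u \<in> R" for u
    proof -
      have "inv\<^bsub>graph_space G\<^esub> u = u"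
        by (rule inv_equality) (use that in \<open>auto simp: radical_iff\<close>)
      then show ?thesis using that by simp
    qed
  qed (simp add: radical_sym_diff)
qed

lemma verts_graph_bar: "verts (graph_bar G r) = (\<lambda>v. proj {v}) ` verts G"
  by (simp add: graph_bar_def Let_def)

text \<open>Vertices are anisotropic, so the form at the sum of two of them is their polar value,
  and this depends only on their images.\<close>

lemma edge_graph_bar_iff:
  assumes xy: "x \<in> verts G" "y \<in> verts G"
  shows "{proj {x}, proj {y}} \<in> edges (graph_bar G r) \<longleftrightarrow> {x, y} \<in> edges G"
proof -
  have N: "normal R (graph_space G)"
    by (rule comm_group.subgroup_imp_normal[OF graph_space_comm_group subgroup_radical])
  have ind: "induced_form (graph_form G r)
      (proj {a} \<otimes>\<^bsub>graph_space G Mod R\<^esub> proj {b}) = 1 \<longleftrightarrow> {a, b} \<in> edges G"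
    if "a \<in> verts G" "b \<in> verts G" for a b
  proof -
    have ab: "{a} \<in> V" "{b} \<in> V" using that by (auto intro: singleton_V)
    have "proj {a} \<otimes>\<^bsub>graph_space G Mod R\<^esub> proj {b} = proj (sym_diff {a} {b})"
      using normal.rcos_sum[OF N, of "{a}" "{b}"] ab by (simp add: proj_radical_def)
    moreover have "induced_form (graph_form G r) (proj (sym_diff {a} {b})) =
        graph_form G r (sym_diff {a} {b})"
      unfolding proj_radical_def graph_radical_def
      using ab Fpow_sym_diff[OF ab] graph_space_comm_group[of G] graph_form_0_iff form_empty
      by (intro induced_form_coset) (auto simp: comm_group_def comm_monoid_def)
    ultimately show ?thesis
      using form_sym_diff[OF ab] form_singleton by (simp add: adj_singletons flip: form_def)
  qed
  have "{proj {x}, proj {y}} \<in> edges (graph_bar G r) \<longleftrightarrow>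
      (\<exists>a\<in>verts G. \<exists>b\<in>verts G. {proj {x}, proj {y}} = {proj {a}, proj {b}} \<and>
        proj {a} \<noteq> proj {b} \<and> {a, b} \<in> edges G)"
    (is "_ \<longleftrightarrow> ?rhs")
  proof -
    have "{proj {x}, proj {y}} \<in> edges (graph_bar G r) \<longleftrightarrow>
        (\<exists>A\<in>verts (graph_bar G r). \<exists>B\<in>verts (graph_bar G r). {proj {x}, proj {y}} = {A, B} \<and>
          A \<noteq> B \<and> induced_form (graph_form G r) (A \<otimes>\<^bsub>graph_space G Mod R\<^esub> B) = 1)"
      unfolding graph_bar_def Let_def graph.simps mem_Collect_eq
      by (rule iffI; elim exE conjE bexE; intro exI conjI bexI; assumption)
    also have "\<dots> \<longleftrightarrow> ?rhs"
      unfolding verts_graph_bar bex_simps(7) using ind by (intro bex_cong refl) simp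
    finally show ?thesis .
  qed
  also have "\<dots> \<longleftrightarrow> {x, y} \<in> edges G"
  proof
    have eq: "adj {a} {b} = adj {a'} {b'}"
      if "proj {a} = proj {a'}" "proj {b} = proj {b'}"
        "a \<in> verts G" "b \<in> verts G" "a' \<in> verts G" "b' \<in> verts G" for a b a' b'
    proof -
      have "nbhd {a} = nbhd {a'}" "nbhd {b} = nbhd {b'}"
        using that proj_eq_P P_singleton by auto
      then show ?thesis using nbhd_eq_adj adj_sym singleton_V that by metis
    qed
    assume "\<exists>a\<in>verts G. \<exists>b\<in>verts G. {proj {x}, proj {y}} = {proj {a}, proj {b}} \<and>
        proj {a} \<noteq> proj {b} \<and> {a, b} \<in> edges G"
    then obtain a b where ab: "a \<in> verts G" "b \<in> verts G" "{a, b} \<in> edges G"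
      "{proj {x}, proj {y}} = {proj {a}, proj {b}}" by blast
    from ab(4) have "adj {x} {y} = adj {a} {b} \<or> adj {x} {y} = adj {b} {a}"
      unfolding doubleton_eq_iff
    proof (elim disjE conjE)
      assume "proj {x} = proj {a}" "proj {y} = proj {b}"
      from eq[OF this xy ab(1,2)] show ?thesis ..
    next
      assume "proj {x} = proj {b}" "proj {y} = proj {a}"
      from eq[OF this xy ab(2,1)] show ?thesis ..
    qed
    then show "{x, y} \<in> edges G"
      using ab by (auto simp: adj_singletons insert_commute)
  next
    assume E: "{x, y} \<in> edges G"
    \<comment> \<open>No edge collapses: equal images would give \<open>x\<close> the neighbourhood
      of \<open>y\<close>, making \<open>y\<close> adjacent to itself.\<close>
    have "proj {x} \<noteq> proj {y}"
    proof
      assume "proj {x} = proj {y}"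
      then have "nbhd {x} = nbhd {y}" using proj_eq_P P_singleton xy by simp
      then have "adj {x} {y} = adj {y} {y}" by (rule nbhd_eq_adj)
      then show False using E edgeD[of y y] by (simp add: adj_singletons)
    qed
    then show "\<exists>a\<in>verts G. \<exists>b\<in>verts G. {proj {x}, proj {y}} = {proj {a}, proj {b}} \<and>
        proj {a} \<noteq> proj {b} \<and> {a, b} \<in> edges G"
      using E xy by (intro bexI[of _ x] bexI[of _ y]) simp_all
  qed
  finally show ?thesis .
qed

section \<open>Collinearity, claws and connectedness\<close>

lemma lines_Pi_space_subset: "l \<in> lines (Pi_space G r) \<Longrightarrow> l \<subseteq> P"
  by (simp add: Pi_space_def pls_restrict_def Let_def)

lemma lines_Pi_bar_subset: "l \<in> lines (Pi_bar G r) \<Longrightarrow> l \<subseteq> points (Pi_bar G r)"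
  using lines_Pi_space_subset by (auto simp: Pi_bar_def pls_image_def)

lemma collinear_Pi_space:
  assumes "p \<in> P" "q \<in> P"
  shows "collinear (Pi_space G r) p q \<longleftrightarrow> adj p q"
proof
  assume "collinear (Pi_space G r) p q"
  then obtain l where l: "p \<noteq> q" "l \<in> lines (Pi_space G r)" "p \<in> l" "q \<in> l"
    by (auto simp: collinear_def)
  then obtain a b where ab: "a \<in> P" "b \<in> P" "adj a b" "l = {a, b, sym_diff a b}"
    unfolding lines_Pi_space mem_Collect_eq by (elim exE conjE)
  show "adj p q"
    by (rule elliptic_line(1)[OF P_V[OF ab(1)] P_V[OF ab(2)] ab(3)]) (use ab l in simp_all)
next
  assume adj: "adj p q"
  then have "p \<noteq> q" using adj_self P_V assms by blast
  moreover have "{p, q, sym_diff p q} \<in> lines (Pi_space G r)" unfolding lines_Pi_space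
    by (intro CollectI exI[of _ p] exI[of _ q] conjI refl assms adj)
  ultimately show "collinear (Pi_space G r) p q" unfolding collinear_def
    by (intro conjI bexI[of _ "{p, q, sym_diff p q}"]) simp_all
qed

lemma proj_sym_diff:
  assumes "proj p = proj p'" "proj q = proj q'"
  shows "proj (sym_diff p q) = proj (sym_diff p' q')"
proof -
  have "sym_diff (sym_diff p q) (sym_diff p' q') = sym_diff (sym_diff p p') (sym_diff q q')"
    by auto
  then show ?thesis
    using radical_sym_diff[of "sym_diff p p'" "sym_diff q q'"] assms by (simp only: proj_eq_iff)
qed

lemma proj_adj:
  assumes "proj p = proj p'" "proj q = proj q'" "p \<in> P" "p' \<in> P" "q \<in> P" "q' \<in> P"
  shows "adj p q = adj p' q'"
proof -
  have "nbhd p = nbhd p'" "nbhd q = nbhd q'" using assms proj_eq_P by auto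
  then have "adj p q = adj p' q" "adj q p' = adj q' p'" by (auto dest: nbhd_eq_adj)
  moreover have "adj p' q = adj q p'" "adj p' q' = adj q' p'"
    using assms(3-) by (auto intro!: adj_sym P_V)
  ultimately show ?thesis by simp
qed

text \<open>The line lifts to a line of \<open>Pi_space G r\<close>, which is rewritten through its
  points \<open>u\<close> and \<open>w\<close> above the two given ones. Polar form and sum both
  descend to the quotient, so \<open>p\<close> and \<open>q\<close> may replace \<open>u\<close> and
  \<open>w\<close>.\<close>

lemma line_Pi_bar:
  assumes l: "l \<in> lines (Pi_bar G r)" "proj p \<in> l" "proj q \<in> l" "proj p \<noteq> proj q"
    and pq: "p \<in> P" "q \<in> P"
  shows "adj p q" "l = {proj p, proj q, proj (sym_diff p q)}"
proof -
  obtain a b where ab: "a \<in> P" "b \<in> P" "adj a b" "l = proj ` {a, b, sym_diff a b}"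
    using l(1) unfolding lines_Pi_bar mem_Collect_eq image_insert image_empty by (elim exE conjE)
  let ?l = "{a, b, sym_diff a b}"
  have lP: "?l \<subseteq> P" using ab P_sym_diff by simp
  obtain u where u: "u \<in> ?l" "proj p = proj u" using l(2) unfolding ab(4) by (rule imageE)
  obtain w where w: "w \<in> ?l" "proj q = proj w" using l(3) unfolding ab(4) by (rule imageE)
  have "u \<noteq> w" using u w l(4) by metis
  note e = elliptic_line[OF P_V[OF ab(1)] P_V[OF ab(2)] ab(3) u(1) w(1) this]
  show "adj p q" using proj_adj[OF u(2) w(2)] u w lP pq e(1) by blast
  have "l = {proj u, proj w, proj (sym_diff u w)}" unfolding ab(4) e(2)[symmetric] by simp
  then show "l = {proj p, proj q, proj (sym_diff p q)}"
    using u(2) w(2) proj_sym_diff[OF u(2) w(2)] by simp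
qed

lemma adj_imp_proj_neq: "p \<in> P \<Longrightarrow> q \<in> P \<Longrightarrow> adj p q \<Longrightarrow> proj p \<noteq> proj q"
  using proj_adj[of p q q q] adj_self P_V by blast

lemma line_Pi_barI:
  assumes "p \<in> P" "q \<in> P" "adj p q"
  shows "{proj p, proj q, proj (sym_diff p q)} \<in> lines (Pi_bar G r)"
  unfolding lines_Pi_bar by (intro CollectI exI[of _ p] exI[of _ q] conjI refl assms)

lemma collinear_Pi_bar:
  assumes "p \<in> P" "q \<in> P"
  shows "collinear (Pi_bar G r) (proj p) (proj q) \<longleftrightarrow> adj p q"
proof
  show "adj p q" if "collinear (Pi_bar G r) (proj p) (proj q)"
    using that line_Pi_bar(1) assms unfolding collinear_def by blast
  show "collinear (Pi_bar G r) (proj p) (proj q)" if "adj p q"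
    unfolding collinear_def
    using adj_imp_proj_neq[OF assms that] line_Pi_barI[OF assms that]
    by (intro conjI bexI[of _ "{proj p, proj q, proj (sym_diff p q)}"]) simp_all
qed

text \<open>Distinct neighbourhoods mean distinct points of the quotient, so this is a claw of
  \<open>Pi_bar G r\<close> given by representatives.\<close>

definition claw :: "'a set \<Rightarrow> 'a set \<Rightarrow> 'a set \<Rightarrow> 'a set \<Rightarrow> bool" where
  "claw a b c d \<longleftrightarrow> a \<in> P \<and> b \<in> P \<and> c \<in> P \<and> d \<in> P \<and>
    adj a b \<and> adj a c \<and> adj a d \<and> \<not> adj b c \<and> \<not> adj b d \<and> \<not> adj c d \<and>
    nbhd b \<noteq> nbhd c \<and> nbhd b \<noteq> nbhd d \<and> nbhd c \<noteq> nbhd d"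

text \<open>A sum of adjacent points is adjacent to its summands. So a closed set descends from any
  of its points to a vertex, runs along paths to all vertices, and climbs back to all
  points.\<close>

lemma adjacency_closed_eq_P:
  assumes conn: "connected_graph G"
    and S: "S \<subseteq> P" "S \<noteq> {}" "\<And>p q. p \<in> S \<Longrightarrow> q \<in> P \<Longrightarrow> adj p q \<Longrightarrow> q \<in> S"
  shows "S = P"
proof -
  have path: "{y} \<in> S" if "(x, y) \<in> {(a, b). {a, b} \<in> edges G}\<^sup>*" "{x} \<in> S" for x y
    using that
  proof (induction rule: rtrancl_induct)
    case (step y z)
    then have "adj {y} {z}" "{z} \<in> P" using adj_singletons edgeD P_singleton by auto
    then show ?case using step S(3) by blast
  qed
  have verts: "p \<in> S \<longrightarrow> (\<forall>v\<in>verts G. {v} \<in> S)" if "p \<in> P" for p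
    using that
  proof (induction p rule: P_induct)
    case (vertex v)
    then show ?case using path conn unfolding connected_graph_def by blast
  next
    case (sum p q)
    have "adj (sym_diff p q) p" using sum adj_self adj_sym P_V by (simp add: adj_left)
    then show ?case using sum S(3) by blast
  qed
  have "p \<in> S" if "p \<in> P" for p
    using that
  proof (induction p rule: P_induct)
    case (vertex v)
    then show ?case using verts S by blast
  next
    case (sum p q)
    have "adj p (sym_diff p q)" using sum adj_self P_V by (simp add: adj_right)
    then show ?case using sum S(3) P_sym_diff by blast
  qed
  then show ?thesis using S(1) by blast
qed

section \<open>The space of neighbourhoods and the claw-free case\<close>

text \<open>The quotient by the isotropic radical is realised on the sets \<^term>\<open>nbhd u\<close>. This may also
  kill an anisotropic radical vector, but points are still separated.\<close>

definition reduced_adj :: "'a set \<Rightarrow> 'a set \<Rightarrow> bool" where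
  "reduced_adj S T \<longleftrightarrow> (\<exists>u\<in>V. \<exists>w\<in>V. S = nbhd u \<and> T = nbhd w \<and> adj u w)"

text \<open>The polar form depends on its first argument only through \<open>nbhd\<close>, and by
  symmetry likewise on the second.\<close>

lemma reduced_adj_nbhd:
  assumes "u \<in> V" "w \<in> V"
  shows "reduced_adj (nbhd u) (nbhd w) \<longleftrightarrow> adj u w"
proof -
  have "adj u w" if "nbhd u = nbhd u'" "nbhd w = nbhd w'" "u' \<in> V" "w' \<in> V" "adj u' w'" for u' w'
    using that assms nbhd_eq_adj adj_sym by metis
  then show ?thesis unfolding reduced_adj_def using assms by blast
qed

lemma nbhd_sdiff: "u \<in> V \<Longrightarrow> w \<in> V \<Longrightarrow> nbhd u \<triangle> nbhd w = nbhd (sym_diff u w)"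
  by (simp add: sdiff_def nbhd_sym_diff)

lemma alternating_space_reduced: "alternating_space (nbhd ` V) reduced_adj"
proof
  have "{} \<in> V" "nbhd {} = {}" using empty_radical by (auto simp: radical_iff)
  then show "{} \<in> nbhd ` V" by (metis image_eqI)
  show "\<not> reduced_adj S S" if "S \<in> nbhd ` V" for S
    using that reduced_adj_nbhd adj_self by auto
  show "reduced_adj S T \<longleftrightarrow> reduced_adj T S" if "S \<in> nbhd ` V" "T \<in> nbhd ` V" for S T
    using that reduced_adj_nbhd adj_sym by auto
  show "reduced_adj (S \<triangle> T) U \<longleftrightarrow> reduced_adj S U \<noteq> reduced_adj T U"
    if STU: "S \<in> nbhd ` V" "T \<in> nbhd ` V" "U \<in> nbhd ` V" for S T U
  proof -
    obtain s t u where "s \<in> V" "t \<in> V" "u \<in> V" "S = nbhd s" "T = nbhd t" "U = nbhd u"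
      using STU by (elim imageE)
    then show ?thesis by (simp only: nbhd_sdiff reduced_adj_nbhd adj_left Fpow_sym_diff)
  qed
  show "S \<triangle> T \<in> nbhd ` V" if ST: "S \<in> nbhd ` V" "T \<in> nbhd ` V" for S T
  proof -
    obtain s t where "s \<in> V" "t \<in> V" "S = nbhd s" "T = nbhd t" using ST by (elim imageE)
    then show ?thesis by (simp only: nbhd_sdiff) (intro imageI Fpow_sym_diff)
  qed
qed

text \<open>Without adjacency every singleton is closed, so connectedness leaves at most one point.
  A set with no or with two elements then serves as \<open>\<Omega>\<close>.\<close>

lemma cotriangular_if_no_adj:
  assumes conn: "connected_graph G" and "\<not> (\<exists>p\<in>P. \<exists>q\<in>P. adj p q)"
  shows "is_cotriangular_space_of_set (Pi_bar G r)"
proof -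
  have lines: "lines (Pi_bar G r) = {}" using assms(2) unfolding lines_Pi_bar by auto
  show ?thesis
  proof (cases "P = {}")
    case True
    have "pls_iso (Pi_bar G r) (cotriangular_space ({} :: bool set))"
      unfolding pls_iso_def lines points_Pi_bar True
      by (auto simp: cotriangular_space_def nsets_def bij_betw_def)
    then show ?thesis by (rule cotriangular_space_of_setI)
  next
    case False
    then obtain p where "p \<in> P" by blast
    then have "{p} = P"
      by (intro adjacency_closed_eq_P[OF conn]) (use assms(2) in auto)
    then have points: "points (Pi_bar G r) = {proj p}" unfolding points_Pi_bar by auto
    have "pls_iso (Pi_bar G r) (cotriangular_space {True, False})"
      unfolding pls_iso_def lines points
      by (intro exI[of _ "\<lambda>_. {True, False}"]) (auto simp: cotriangular_space_def bij_betw_def)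
    then show ?thesis by (rule cotriangular_space_of_setI)
  qed
qed

text \<open>For points, equal cosets are the same as equal neighbourhoods, so \<open>f\<close> is
  independent of the representative that \<open>inv_into\<close> picks, and it is injective. Lines
  follow because \<open>nbhd\<close> is additive.\<close>

lemma pls_iso_Pi_bar_reduced:
  "pls_iso (Pi_bar G r) \<lparr>points = nbhd ` P, lines = {{S, T, S \<triangle> T} | S T.
    S \<in> nbhd ` P \<and> T \<in> nbhd ` P \<and> reduced_adj S T}\<rparr>"
proof -
  define f where "f C = nbhd (inv_into P proj C)" for C
  have f: "f (proj p) = nbhd p" if "p \<in> P" for p
  proof -
    have "inv_into P proj (proj p) \<in> P" "proj (inv_into P proj (proj p)) = proj p"
      using that by (simp_all add: inv_into_into f_inv_into_f)
    then show ?thesis using that proj_eq_P by (simp add: f_def)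
  qed
  have "inj_on f (proj ` P)"
  proof (rule inj_onI)
    fix x y assume "x \<in> proj ` P" "y \<in> proj ` P" "f x = f y"
    then obtain p q where "x = proj p" "y = proj q" "p \<in> P" "q \<in> P" "nbhd p = nbhd q"
      using f by auto
    then show "x = y" using proj_eq_P by simp
  qed
  moreover have "f ` (proj ` P) = nbhd ` P"
    unfolding image_image using f by simp
  ultimately have bij: "bij_betw f (points (Pi_bar G r)) (nbhd ` P)"
    by (simp add: bij_betw_def points_Pi_bar)
  have img: "f ` {proj a, proj b, proj (sym_diff a b)} = {nbhd a, nbhd b, nbhd a \<triangle> nbhd b}"
    if "a \<in> P" "b \<in> P" "adj a b" for a b
    using that f P_sym_diff[OF that] P_V by (simp only: image_insert image_empty nbhd_sdiff)
  have radj: "reduced_adj (nbhd p) (nbhd q) \<longleftrightarrow> adj p q" if "p \<in> P" "q \<in> P" for p q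
    using that P_V reduced_adj_nbhd by blast
  have "(\<lambda>l. f ` l) ` lines (Pi_bar G r) =
      {{S, T, S \<triangle> T} | S T. S \<in> nbhd ` P \<and> T \<in> nbhd ` P \<and> reduced_adj S T}"
  proof (intro equalityI subsetI)
    fix l assume "l \<in> (\<lambda>l. f ` l) ` lines (Pi_bar G r)"
    then obtain a b where ab: "a \<in> P" "b \<in> P" "adj a b"
      and l: "l = f ` {proj a, proj b, proj (sym_diff a b)}"
      unfolding lines_Pi_bar image_setcompr2 mem_Collect_eq by (elim exE conjE)
    have "reduced_adj (nbhd a) (nbhd b)" using radj ab by simp
    then show "l \<in> {{S, T, S \<triangle> T} | S T. S \<in> nbhd ` P \<and> T \<in> nbhd ` P \<and> reduced_adj S T}"
      unfolding l img[OF ab]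
      by (intro CollectI exI[of _ "nbhd a"] exI[of _ "nbhd b"] conjI refl imageI ab)
  next
    fix l assume "l \<in> {{S, T, S \<triangle> T} | S T. S \<in> nbhd ` P \<and> T \<in> nbhd ` P \<and> reduced_adj S T}"
    then obtain a b where ab: "a \<in> P" "b \<in> P" "reduced_adj (nbhd a) (nbhd b)"
      and l: "l = {nbhd a, nbhd b, nbhd a \<triangle> nbhd b}" by blast
    from ab(3) have "adj a b" using radj ab by simp
    note ab = ab(1,2) this
    show "l \<in> (\<lambda>l. f ` l) ` lines (Pi_bar G r)"
      unfolding l img[OF ab, symmetric] by (intro imageI line_Pi_barI ab)
  qed
  with bij show ?thesis unfolding pls_iso_def pls.simps by blast
qed

lemma cotriangular_if_claw_free:
  assumes conn: "connected_graph G" and claw: "\<nexists>a b c d. claw a b c d"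
  shows "is_cotriangular_space_of_set (Pi_bar G r)"
proof (cases "\<exists>p\<in>P. \<exists>q\<in>P. adj p q")
  case False
  then show ?thesis using cotriangular_if_no_adj[OF conn] by blast
next
  case True
  then obtain a b where ab: "a \<in> P" "b \<in> P" "adj a b" by blast
  interpret reduced: alternating_space "nbhd ` V" reduced_adj by (rule alternating_space_reduced)
  let ?N = "nbhd ` P"
  have radj: "reduced_adj (nbhd p) (nbhd q) \<longleftrightarrow> adj p q" if "p \<in> P" "q \<in> P" for p q
    using that P_V reduced_adj_nbhd by blast
  have "is_cotriangular_space_of_set
    \<lparr>points = ?N, lines = {{S, T, S \<triangle> T} | S T. S \<in> ?N \<and> T \<in> ?N \<and> reduced_adj S T}\<rparr>"
  proof (rule reduced.claw_free_cotriangular)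
    show "?N \<subseteq> nbhd ` V" using P_V by blast
    show "nbhd a \<in> ?N" "nbhd b \<in> ?N" "reduced_adj (nbhd a) (nbhd b)" using ab radj by auto
    \<comment> \<open>A point with empty neighbourhood is adjacent to nothing, so by connectedness
      it would be the only point, against \<open>adj a b\<close>.\<close>
    show "{} \<notin> ?N"
    proof
      assume "{} \<in> ?N"
      then obtain p where p: "p \<in> P" "nbhd p = {}" by auto
      have "{p} = P"
        by (rule adjacency_closed_eq_P[OF conn]) (use p in \<open>auto simp: adj_def\<close>)
      then have "a = p" "b = p" using ab by auto
      then show False using ab adj_self P_V by blast
    qed
    show "S \<triangle> T \<in> ?N" if ST: "S \<in> ?N" "T \<in> ?N" "reduced_adj S T" for S T
    proof -
      obtain s t where st: "s \<in> P" "t \<in> P" "S = nbhd s" "T = nbhd t" using ST by (elim imageE)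
      then have "adj s t" using ST radj by simp
      then have "nbhd (sym_diff s t) \<in> ?N" using P_sym_diff st by blast
      then show ?thesis using st nbhd_sdiff P_V by simp
    qed
    show "S = ?N" if S: "S \<subseteq> ?N" "S \<noteq> {}"
      and cl: "\<And>p q. p \<in> S \<Longrightarrow> q \<in> ?N \<Longrightarrow> reduced_adj p q \<Longrightarrow> q \<in> S" for S
    proof -
      have "{p \<in> P. nbhd p \<in> S} = P"
      proof (rule adjacency_closed_eq_P[OF conn])
        show "q \<in> {p \<in> P. nbhd p \<in> S}" if "p \<in> {p \<in> P. nbhd p \<in> S}" "q \<in> P" "adj p q" for p q
          using that cl[of "nbhd p" "nbhd q"] radj by auto
      qed (use S in auto)
      then show ?thesis using S by auto
    qed
    fix S T U W assume S: "S \<in> ?N" "T \<in> ?N" "U \<in> ?N" "W \<in> ?N"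
      "reduced_adj S T" "reduced_adj S U" "reduced_adj S W"
      "\<not> reduced_adj T U" "\<not> reduced_adj T W" "\<not> reduced_adj U W"
    obtain s t u w where eq: "S = nbhd s" "T = nbhd t" "U = nbhd u" "W = nbhd w"
      and P: "s \<in> P" "t \<in> P" "u \<in> P" "w \<in> P" using S(1-4) by (elim imageE)
    then show "T = U \<or> T = W \<or> U = W"
      using S(5-) claw unfolding eq claw_def by (simp add: radj) meson
  qed
  then obtain \<Omega> :: "('a set \<times> bool) set" where "pls_iso
      \<lparr>points = ?N, lines = {{S, T, S \<triangle> T} | S T. S \<in> ?N \<and> T \<in> ?N \<and> reduced_adj S T}\<rparr>
      (cotriangular_space \<Omega>)"
    unfolding is_cotriangular_space_of_set_def by blast
  \<comment> \<open>The set \<open>\<Omega>\<close> lives over the type of the neighbourhood space;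
    \<open>cotriangular_space_of_setI\<close> moves it to the type belonging to the cosets.\<close>
  from pls_iso_trans[OF pls_iso_Pi_bar_reduced this] show ?thesis
    by (rule cotriangular_space_of_setI)
qed

section \<open>Line graphs: points as pairs of ends\<close>

lemma claw_free_if_line_graph:
  assumes "is_line_graph_of_multi_graph G"
  shows "\<not> claw a b c d"
proof
  assume claw: "claw a b c d"
  obtain M :: "('a \<times> bool, 'a) mgraph" and f where M: "multi_graph M"
    and f: "bij_betw f (verts G) (medges M)"
    and edge: "\<And>x y. x \<in> verts G \<Longrightarrow> y \<in> verts G \<Longrightarrow>
      {x, y} \<in> edges G \<longleftrightarrow> {f x, f y} \<in> edges (line_graph M)"
    using assms by (auto simp: is_line_graph_of_multi_graph_def graph_iso_def line_graph_def)
  define h where "h x = ends M (f x)" for x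
  define H where "H = sym_diff_sum h"
  have fm: "f x \<in> medges M" if "x \<in> verts G" for x using f that by (auto simp: bij_betw_def)
  have h: "finite (h x)" "card (h x) = 2" if "x \<in> verts G" for x
    using M fm[OF that] by (auto simp: multi_graph_def nsets_def h_def)
  have adjH: "adj u w \<longleftrightarrow> odd (card (H u \<inter> H w))" if uw: "u \<in> V" "w \<in> V" for u w
  proof (rule biadditive_on_unique[OF biadditive_adj _ _ uw])
    show "biadditive_on (verts G) (\<lambda>u w. odd (card (H u \<inter> H w)))"
      unfolding H_def by (rule biadditive_on_sym_diff_sum) (rule h)
    fix x y assume xy: "x \<in> verts G" "y \<in> verts G"
    \<comment> \<open>Two 2-sets meet in 0, 1 or 2 elements, so odd means exactly one. Parallel
      edges meet in 2, in accordance with their non-adjacency.\<close>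
    have "card (h x \<inter> h y) \<le> 2" using h[OF xy(1)] card_mono[of "h x" "h x \<inter> h y"] by simp
    then have "card (h x \<inter> h y) \<in> {0, 1, 2}" by auto
    then have "odd (card (h x \<inter> h y)) \<longleftrightarrow> card (h x \<inter> h y) = 1" by auto
    then show "adj {x} {y} = odd (card (H {x} \<inter> H {y}))"
      using xy fm by (simp add: adj_singletons edge line_graph_edge_iff H_def flip: h_def)
  qed
  \<comment> \<open>Adjacent 2-sets share exactly one element, so their symmetric difference is
    again a 2-set.\<close>
  have card2: "card (H p) = 2" if "p \<in> P" for p
    using that
  proof (induction p rule: P_induct)
    case (vertex v)
    then show ?case using h by (simp add: H_def)
  next
    case (sum p q)
    have fin: "finite (H p)" "finite (H q)" using sum by (auto intro: card_ge_0_finite)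
    have "odd (card (H p \<inter> H q))" using adjH sum P_V by blast
    moreover have "card (H p \<inter> H q) \<le> 2" using sum fin card_mono[of "H p" "H p \<inter> H q"] by simp
    ultimately have "card (H p \<inter> H q) = 1"
      by (metis One_nat_def even_numeral le_SucE le_0_eq numeral_2_eq_2 odd_card_imp_not_empty
          card.empty even_zero)
    then have "card (H p - H q) = 1" "card (H q - H p) = 1"
      using sum fin card_Int_Diff[of "H p" "H q"] card_Int_Diff[of "H q" "H p"]
      by (simp_all add: Int_commute)
    moreover have "H (sym_diff p q) = sym_diff (H p) (H q)"
      unfolding H_def using sum P_V by (intro sym_diff_sum_sym_diff) (auto simp: Fpow_def)
    moreover have "card (sym_diff (H p) (H q)) = card (H p - H q) + card (H q - H p)"
      using fin by (intro card_Un_disjoint) auto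
    ultimately show ?case by simp
  qed
  have Heq: "nbhd p = nbhd q" if "p \<in> P" "q \<in> P" "H p = H q" for p q
  proof -
    have "x \<in> nbhd p \<longleftrightarrow> x \<in> nbhd q" if "x \<in> verts G" for x
      using adjH[OF P_V singleton_V[OF that]] \<open>p \<in> P\<close> \<open>q \<in> P\<close> \<open>H p = H q\<close>
      by (simp flip: adj_singleton_right)
    then show ?thesis using nbhd_subset by blast
  qed
  have P: "a \<in> P" "b \<in> P" "c \<in> P" "d \<in> P" using claw by (auto simp: claw_def)
  obtain x y where Ha: "H a = {x, y}" using card2[OF P(1)] by (auto simp: card_2_iff)
  have meet: "x \<in> H p \<or> y \<in> H p" if "p \<in> P" "adj a p" for p
  proof -
    have "odd (card (H a \<inter> H p))" using adjH P_V P that by blast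
    then have "H a \<inter> H p \<noteq> {}" by (metis card.empty even_zero)
    then show ?thesis using Ha by auto
  qed
  \<comment> \<open>For non-adjacent points the intersection is even; containing \<open>z\<close>,
    it has at least two elements, so the two 2-sets coincide.\<close>
  have same: "nbhd p = nbhd q" if pq: "p \<in> P" "q \<in> P" "\<not> adj p q" and z: "z \<in> H p" "z \<in> H q" for p q z
  proof -
    have fin: "finite (H p)" "finite (H q)" using card2 pq by (auto intro: card_ge_0_finite)
    have "even (card (H p \<inter> H q))" using adjH P_V pq by blast
    moreover have "card (H p \<inter> H q) \<noteq> 0" using z fin by auto
    ultimately have "card (H p \<inter> H q) \<ge> 2" by (auto elim!: evenE)
    then have "H p \<inter> H q = H p" "H p \<inter> H q = H q"
      using fin card2 pq by (simp_all only: card_seteq Int_lower1 Int_lower2)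
    then have "H p = H q" by (rule trans[OF sym])
    with pq(1,2) show ?thesis by (rule Heq)
  qed
  show False
    using meet[of b] meet[of c] meet[of d] P claw same[of b c] same[of b d] same[of c d]
    unfolding claw_def by metis
qed

end

section \<open>The orthogonal space of \<open>D4_graph\<close>\<close>

interpretation D4: ordered_graph D4_graph less_than
proof
  show "ordinary_graph D4_graph" by (auto simp: ordinary_graph_def D4_graph_def)
  show "strict_linear_order_on (verts D4_graph) less_than"
    by (auto simp: strict_linear_order_on_def irrefl_def total_on_def trans_less_than)
qed

lemma D4_verts: "verts D4_graph = {0, 1, 2, 3}"
  by (simp add: D4_graph_def)

text \<open>Orthogonality to the leaf 1 excludes the centre 0, and orthogonality to the centre
  forces an even number of leaves.\<close>

lemma D4_nbhd_empty:
  assumes "C \<in> D4.V" "D4.nbhd C = {}"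
  shows "C \<in> {{}, {1, 2}, {1, 3}, {2, 3}}"
proof -
  have adj: "even (card (C \<inter> D4.nbhd {v}))" if "v \<in> {0, 1, 2, 3}" for v
  proof -
    have "\<not> D4.adj C {v}" using assms(2) by (simp add: D4.adj_def)
    then have "\<not> D4.adj {v} C"
      using D4.adj_sym[OF assms(1) D4.singleton_V] that by (simp add: D4_verts)
    then show ?thesis by (simp add: D4.adj_def)
  qed
  have "D4.nbhd {1} = {0}" "D4.nbhd {0} = {1, 2, 3}"
    unfolding D4.nbhd_def sym_diff_sum_singleton by (auto simp: D4_graph_def doubleton_eq_iff)
  then have e: "even (card (C \<inter> {0}))" "even (card (C \<inter> {1, 2, 3}))"
    using adj[of 1] adj[of 0] by simp_all
  have "0 \<notin> C"
  proof
    assume "0 \<in> C"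
    then have "C \<inter> {0} = {0}" by auto
    then show False using e by simp
  qed
  then have "C \<subseteq> {1, 2, 3}" using assms(1) by (auto simp: Fpow_def D4_verts)
  then have "C \<in> Pow {1, 2, 3}" "even (card C)" using e(2) by (auto simp: Int_absorb2)
  then show ?thesis by (auto simp: Pow_insert)
qed

section \<open>Claws and subspaces isomorphic to \<open>Pi_D4\<close>\<close>

context ordered_graph
begin

text \<open>The vertices of \<open>D4_graph\<close> are a claw in \<open>Pi_D4\<close>. Its
  collinearities pass through the isomorphism and the restriction to \<open>S\<close>, and
  injectivity keeps the images distinct.\<close>

lemma claw_of_D4_subspace:
  assumes S: "pls_subspace (Pi_bar G r) S" and iso: "pls_iso (pls_restrict (Pi_bar G r) S) Pi_D4"
  shows "\<exists>a b c d. claw a b c d"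
proof -
  have "pls_iso Pi_D4 (pls_restrict (Pi_bar G r) S)"
    by (rule pls_iso_sym[OF iso]) (auto simp: pls_restrict_def)
  then obtain f where f: "bij_betw f (points Pi_D4) S"
    "(\<lambda>l. f ` l) ` lines Pi_D4 = lines (pls_restrict (Pi_bar G r) S)"
    by (auto simp: pls_iso_def pls_restrict_def)
  have D: "{v} \<in> points Pi_D4" if "v \<in> {0, 1, 2, 3}" for v
    using D4.P_singleton that by (simp add: D4_verts Pi_D4_def)
  have "S \<subseteq> proj ` P" using S by (simp add: pls_subspace_def points_Pi_bar)
  moreover have fS: "f {v} \<in> S" if "v \<in> {0, 1, 2, 3}" for v
    using bij_betwE[OF f(1)] D[OF that] by simp
  ultimately have "\<forall>v\<in>{0, 1, 2, 3}. \<exists>p. p \<in> P \<and> f {v} = proj p" by fast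
  from bchoice[OF this] obtain p
    where "\<forall>v\<in>{0, 1, 2, 3}. p v \<in> P \<and> f {v} = proj (p v)" by (elim exE)
  note p = bspec[OF this]
  have adj: "adj (p v) (p w) \<longleftrightarrow> {v, w} \<in> edges D4_graph"
    if vw: "v \<in> {0, 1, 2, 3}" "w \<in> {0, 1, 2, 3}" for v w
  proof -
    have "adj (p v) (p w) \<longleftrightarrow> collinear (Pi_bar G r) (f {v}) (f {w})"
      using collinear_Pi_bar p vw by simp
    also have "\<dots> \<longleftrightarrow> collinear (pls_restrict (Pi_bar G r) S) (f {v}) (f {w})"
      using collinear_restrict[OF S fS fS, OF vw] by simp
    also have "\<dots> \<longleftrightarrow> collinear Pi_D4 {v} {w}"
    proof (rule collinear_iso[OF _ f(2)])
      show "bij_betw f (points Pi_D4) (points (pls_restrict (Pi_bar G r) S))"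
        using f(1) by (simp add: pls_restrict_def)
    qed (use D vw D4.lines_Pi_space_subset in \<open>simp_all add: Pi_D4_def\<close>)
    also have "\<dots> \<longleftrightarrow> {v, w} \<in> edges D4_graph"
      unfolding Pi_D4_def using D[unfolded Pi_D4_def] vw
      by (simp only: D4.collinear_Pi_space D4.adj_singletons)
    finally show ?thesis .
  qed
  have ne: "nbhd (p v) \<noteq> nbhd (p w)"
    if vw: "v \<in> {0, 1, 2, 3}" "w \<in> {0, 1, 2, 3}" "v \<noteq> w" for v w
  proof -
    have "f {v} \<noteq> f {w}"
      using inj_onD[OF bij_betw_imp_inj_on[OF f(1)], of "{v}" "{w}"] D vw by auto
    then show ?thesis using proj_eq_P p vw by simp
  qed
  have "claw (p 0) (p 1) (p 2) (p 3)"
    unfolding claw_def using adj ne p by (simp add: D4_graph_def doubleton_eq_iff)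
  then show ?thesis by blast
qed

text \<open>The linear extension \<open>\<Phi>\<close> of the map from vertices to claw points
  preserves the polar form, as a check on vertices shows. Hence it sends points to points, and
  \<open>f\<close> embeds \<open>Pi_D4\<close> in the quotient.\<close>

lemma D4_subspace_of_claw:
  assumes claw: "claw a b c d"
  shows "\<exists>S. pls_subspace (Pi_bar G r) S \<and> pls_iso (pls_restrict (Pi_bar G r) S) Pi_D4"
proof -
  \<comment> \<open>The centre 0 goes to \<open>a\<close>. The last branch serves the leaf 3 and
    also keeps \<open>k i\<close> in \<open>P\<close> for every \<open>i\<close>.\<close>
  define k where "k i = (if i = 0 then a else if i = 1 then b else if i = 2 then c else d)" for i :: nat
  define \<Phi> where "\<Phi> = sym_diff_sum k"
  have k: "k i \<in> P" for i using claw by (auto simp: k_def claw_def)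
  have \<Phi>_single: "\<Phi> {i} = k i" for i by (simp add: \<Phi>_def)
  have \<Phi>_sum: "\<Phi> (sym_diff A B) = sym_diff (\<Phi> A) (\<Phi> B)" if "A \<in> D4.V" "B \<in> D4.V" for A B
    unfolding \<Phi>_def using that by (intro sym_diff_sum_sym_diff) (auto simp: Fpow_def)
  have \<Phi>_V: "\<Phi> A \<in> V" if "A \<in> D4.V" for A
  proof -
    have "\<Union> (k ` A) \<in> V" using that k[THEN P_V] by (fastforce simp: Fpow_def)
    then show ?thesis using sym_diff_sum_subset[of k A] finite_subset
      unfolding \<Phi>_def Fpow_def by blast
  qed
  have \<Phi>_adj: "D4.adj A B \<longleftrightarrow> adj (\<Phi> A) (\<Phi> B)" if AB: "A \<in> D4.V" "B \<in> D4.V" for A B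
  proof (rule biadditive_on_unique[OF D4.biadditive_adj _ _ AB])
    show "biadditive_on (verts D4_graph) (\<lambda>A B. adj (\<Phi> A) (\<Phi> B))"
      unfolding biadditive_on_def additive_on_def
      by (simp add: \<Phi>_sum adj_left adj_right \<Phi>_V)
    have ksym: "adj (k i) (k j) = adj (k j) (k i)" for i j using adj_sym k P_V by blast
    have kself: "\<not> adj (k i) (k i)" for i using adj_self k P_V by blast
    have k0: "adj (k 0) (k 1)" "adj (k 0) (k 2)" "adj (k 0) (k 3)"
      "\<not> adj (k 1) (k 2)" "\<not> adj (k 1) (k 3)" "\<not> adj (k 2) (k 3)"
      using claw by (auto simp: k_def claw_def)
    fix x y assume xy: "x \<in> verts D4_graph" "y \<in> verts D4_graph"
    have "{x, y} \<in> edges D4_graph \<longleftrightarrow> adj (k x) (k y)"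
      using xy k0 kself ksym[of 1 0] ksym[of 2 0] ksym[of 3 0] ksym[of 2 1] ksym[of 3 1] ksym[of 3 2]
      unfolding D4_graph_def graph.simps
      by (elim insertE emptyE) (simp_all add: doubleton_eq_iff)
    then show "D4.adj {x} {y} = adj (\<Phi> {x}) (\<Phi> {y})"
      by (simp add: D4.adj_singletons \<Phi>_single)
  qed
  have \<Phi>_P: "\<Phi> A \<in> P" if "A \<in> D4.P" for A
    using that
  proof (induction A rule: D4.P_induct)
    case (vertex v)
    then show ?case by (simp add: \<Phi>_single k)
  next
    case (sum A B)
    then have "adj (\<Phi> A) (\<Phi> B)" using \<Phi>_adj D4.P_V by blast
    then have "sym_diff (\<Phi> A) (\<Phi> B) \<in> P" using sum P_sym_diff by blast
    then show ?case using \<Phi>_sum sum D4.P_V by simp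
  qed
  \<comment> \<open>The sum of \<open>A\<close> and \<open>B\<close> lies in the radical of the
    polar form of \<open>D4_graph\<close>, so it is empty or a pair of leaves. A pair would give two
    leaves of the claw the same neighbourhood.\<close>
  have \<Phi>_inj: "A = B" if AB: "A \<in> D4.P" "B \<in> D4.P" "nbhd (\<Phi> A) = nbhd (\<Phi> B)" for A B
  proof -
    let ?C = "sym_diff A B"
    have AV: "A \<in> D4.V" "B \<in> D4.V" using AB D4.P_V by auto
    then have C: "?C \<in> D4.V" by (rule Fpow_sym_diff)
    have n: "nbhd (\<Phi> ?C) = {}" using AB(3) AV \<Phi>_V by (simp add: \<Phi>_sum nbhd_sym_diff)
    then have "\<not> D4.adj ?C B" if "B \<in> D4.V" for B
      using \<Phi>_adj[OF C that] by (simp add: adj_def)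
    then have "D4.nbhd ?C = {}" using D4.nbhd_empty_iff[OF C] by blast
    from D4_nbhd_empty[OF C this] have C': "?C = {} \<or> ?C = {1, 2} \<or> ?C = {1, 3} \<or> ?C = {2, 3}"
      by (simp only: insert_iff empty_iff simp_thms)
    have pair: "?C \<noteq> {i, j}" if ij: "i \<in> verts D4_graph" "j \<in> verts D4_graph" "i \<noteq> j"
      "nbhd (k i) \<noteq> nbhd (k j)" for i j
    proof
      assume "?C = {i, j}"
      moreover have "{i, j} = sym_diff {i} {j}" using ij by auto
      ultimately have "\<Phi> ?C = sym_diff (\<Phi> {i}) (\<Phi> {j})"
        using \<Phi>_sum[OF D4.singleton_V D4.singleton_V] ij by metis
      then have "nbhd (\<Phi> ?C) = sym_diff (nbhd (k i)) (nbhd (k j))"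
        using nbhd_sym_diff k P_V by (simp add: \<Phi>_single)
      then show False using n ij by auto
    qed
    have "?C = {}"
      using C' pair[of 1 2] pair[of 1 3] pair[of 2 3] claw
      by (auto simp: k_def claw_def D4_verts)
    then show ?thesis by auto
  qed
  define f where "f A = proj (\<Phi> A)" for A
  define S where "S = f ` D4.P"
  have f_sum: "f (sym_diff A B) = proj (sym_diff (\<Phi> A) (\<Phi> B))" if "A \<in> D4.P" "B \<in> D4.P" for A B
    unfolding f_def using \<Phi>_sum that D4.P_V by simp
  \<comment> \<open>A line with two points in the image is spanned by them, and their adjacency
    pulls back along \<open>\<Phi>\<close>. This yields both the subspace property and surjectivity
    on lines.\<close>
  have f_line: "l = f ` {A, B, sym_diff A B}" "D4.adj A B"
    if "l \<in> lines (Pi_bar G r)" "f A \<in> l" "f B \<in> l" "f A \<noteq> f B" "A \<in> D4.P" "B \<in> D4.P" for l A B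
  proof -
    note * = line_Pi_bar[OF that(1-4)[unfolded f_def] \<Phi>_P[OF that(5)] \<Phi>_P[OF that(6)]]
    show "l = f ` {A, B, sym_diff A B}"
      using *(2) f_sum[OF that(5,6)] by (simp add: f_def)
    show "D4.adj A B" using *(1) \<Phi>_adj that(5,6) D4.P_V by blast
  qed
  have line_S: "f ` {A, B, sym_diff A B} \<subseteq> S" if "A \<in> D4.P" "B \<in> D4.P" "D4.adj A B" for A B
    unfolding S_def using D4.P_sym_diff[OF that] that by (intro image_mono) simp
  have sub: "pls_subspace (Pi_bar G r) S"
    unfolding pls_subspace_def
  proof (intro conjI ballI impI)
    show "S \<subseteq> points (Pi_bar G r)" using \<Phi>_P by (auto simp: S_def f_def points_Pi_bar)
    fix l assume l: "l \<in> lines (Pi_bar G r)" and "\<exists>x\<in>l \<inter> S. \<exists>y\<in>l \<inter> S. x \<noteq> y"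
    then obtain A B where AB: "A \<in> D4.P" "B \<in> D4.P" "f A \<in> l" "f B \<in> l" "f A \<noteq> f B"
      by (auto simp: S_def)
    note * = f_line[OF l AB(3-5,1,2)]
    show "l \<subseteq> S" by (subst *(1)) (rule line_S[OF AB(1,2) *(2)])
  qed
  have inj: "inj_on f D4.P"
    using \<Phi>_inj \<Phi>_P by (auto simp: inj_on_def f_def proj_eq_P)
  have lines: "(\<lambda>l. f ` l) ` lines Pi_D4 = {l \<in> lines (Pi_bar G r). l \<subseteq> S}"
  proof (intro equalityI subsetI)
    fix l assume "l \<in> (\<lambda>l. f ` l) ` lines Pi_D4"
    then obtain A B where AB: "A \<in> D4.P" "B \<in> D4.P" "D4.adj A B" and l: "l = f ` {A, B, sym_diff A B}"
      unfolding Pi_D4_def D4.lines_Pi_space image_setcompr2 mem_Collect_eq by (elim exE conjE)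
    have "adj (\<Phi> A) (\<Phi> B)" using \<Phi>_adj AB D4.P_V by blast
    moreover have "l = {proj (\<Phi> A), proj (\<Phi> B), proj (sym_diff (\<Phi> A) (\<Phi> B))}"
      unfolding l using f_sum[OF AB(1,2)] by (simp add: f_def)
    ultimately have "l \<in> lines (Pi_bar G r)" using line_Pi_barI \<Phi>_P AB(1,2) by simp
    then show "l \<in> {l \<in> lines (Pi_bar G r). l \<subseteq> S}" using line_S[OF AB] l by simp
  next
    fix l assume "l \<in> {l \<in> lines (Pi_bar G r). l \<subseteq> S}"
    then have l: "l \<in> lines (Pi_bar G r)" "l \<subseteq> S" by auto
    obtain p q where pq: "p \<in> P" "q \<in> P" "adj p q" "proj p \<in> l" "proj q \<in> l"
      using l(1) unfolding lines_Pi_bar by auto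
    then have ne: "proj p \<noteq> proj q" using adj_imp_proj_neq by simp
    have "proj p \<in> f ` D4.P" "proj q \<in> f ` D4.P" using l(2) pq(4,5) by (auto simp: S_def)
    then obtain A B where AB: "A \<in> D4.P" "B \<in> D4.P" "proj p = f A" "proj q = f B"
      by (elim imageE)
    note * = f_line[OF l(1) pq(4,5)[unfolded AB(3,4)] ne[unfolded AB(3,4)] AB(1,2)]
    have "{A, B, sym_diff A B} \<in> lines Pi_D4"
      unfolding Pi_D4_def D4.lines_Pi_space
      by (intro CollectI exI[of _ A] exI[of _ B] conjI refl AB *(2))
    then show "l \<in> (\<lambda>l. f ` l) ` lines Pi_D4" using *(1) by (rule rev_image_eqI)
  qed
  have "pls_iso Pi_D4 (pls_restrict (Pi_bar G r) S)"
    unfolding pls_iso_def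
    by (intro exI[of _ f] conjI)
      (use inj lines in \<open>simp_all add: bij_betw_def pls_restrict_def S_def Pi_D4_def\<close>)
  then have "pls_iso (pls_restrict (Pi_bar G r) S) Pi_D4"
    by (rule pls_iso_sym) (use D4.lines_Pi_space_subset in \<open>simp add: Pi_D4_def\<close>)
  with sub show ?thesis by blast
qed

section \<open>Root graphs from 2-sets and from the quotient graph\<close>

lemma line_graph_bar_if_cotriangular:
  assumes "is_cotriangular_space_of_set (Pi_bar G r)"
  shows "is_line_graph_of_ordinary_graph (graph_bar G r)"
proof -
  obtain \<Omega> :: "('a set set \<times> bool) set" and f
    where f: "bij_betw f (points (Pi_bar G r)) ([\<Omega>]\<^bsup>2\<^esup>)"
      "(\<lambda>l. f ` l) ` lines (Pi_bar G r) = lines (cotriangular_space \<Omega>)"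
    using assms by (auto simp: is_cotriangular_space_of_set_def pls_iso_def cotriangular_space_def)
  have f': "bij_betw f (points (Pi_bar G r)) (points (cotriangular_space \<Omega>))"
    using f(1) by (simp add: cotriangular_space_def)
  let ?W = "verts (graph_bar G r)"
  \<comment> \<open>Of the 2-sets of \<open>\<Omega>\<close>, the edges are those that
    \<open>f\<close> assigns to vertices of the quotient graph.\<close>
  define H where "H = \<lparr>verts = \<Omega>, edges = f ` ?W\<rparr>"
  have W: "?W \<subseteq> points (Pi_bar G r)"
    using P_singleton by (auto simp: verts_graph_bar points_Pi_bar)
  have fW: "f x \<in> [\<Omega>]\<^bsup>2\<^esup>" if "x \<in> ?W" for x using W f(1) that by (auto simp: bij_betw_def)
  have "ordinary_graph H" using fW by (auto simp: ordinary_graph_def H_def)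
  moreover have "graph_iso (graph_bar G r) (line_graph (mgraph_of H))"
    unfolding graph_iso_def
  proof (intro exI[of _ f] conjI ballI)
    show "bij_betw f ?W (verts (line_graph (mgraph_of H)))"
      using inj_on_subset[OF bij_betw_imp_inj_on[OF f(1)] W]
      by (simp add: line_graph_def mgraph_of_def H_def bij_betw_def)
    fix x y assume "x \<in> ?W" "y \<in> ?W"
    then obtain v w where vw: "x = proj {v}" "y = proj {w}" "v \<in> verts G" "w \<in> verts G"
      unfolding verts_graph_bar by (elim imageE)
    have xy: "x \<in> points (Pi_bar G r)" "y \<in> points (Pi_bar G r)" using \<open>x \<in> ?W\<close> \<open>y \<in> ?W\<close> W by auto
    \<comment> \<open>Adjacency is collinearity in the quotient space, which the isomorphism carries
      to collinearity of 2-sets, that is, to meeting in one element.\<close>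
    have "{x, y} \<in> edges (graph_bar G r) \<longleftrightarrow> adj {v} {w}"
      unfolding vw(1,2) using edge_graph_bar_iff vw(3,4) by (simp add: adj_singletons)
    also have "\<dots> \<longleftrightarrow> collinear (Pi_bar G r) x y"
      unfolding vw(1,2) using collinear_Pi_bar P_singleton vw(3,4) by simp
    also have "\<dots> \<longleftrightarrow> collinear (cotriangular_space \<Omega>) (f x) (f y)"
      using collinear_iso[OF f' f(2) lines_Pi_bar_subset xy] by simp
    also have "\<dots> \<longleftrightarrow> card (f x \<inter> f y) = 1"
      by (rule collinear_cotriangular_space) (use fW \<open>x \<in> ?W\<close> \<open>y \<in> ?W\<close> in auto)
    also have "\<dots> \<longleftrightarrow> {f x, f y} \<in> edges (line_graph (mgraph_of H))"
      using \<open>x \<in> ?W\<close> \<open>y \<in> ?W\<close> by (simp add: line_graph_edge_iff mgraph_of_def H_def)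
    finally show "{x, y} \<in> edges (graph_bar G r) \<longleftrightarrow>
        {f x, f y} \<in> edges (line_graph (mgraph_of H))" .
  qed
  ultimately show ?thesis by (rule line_graph_of_ordinary_graphI)
qed

text \<open>Vertices with the same image become parallel edges. Their two common ends make them
  non-adjacent in the line graph, just as they are in \<open>G\<close>.\<close>

lemma line_graph_if_line_graph_bar:
  assumes "is_line_graph_of_ordinary_graph (graph_bar G r)"
  shows "is_line_graph_of_multi_graph G"
proof -
  let ?B = "graph_bar G r"
  obtain H :: "('a set set \<times> bool) graph" and f where H: "ordinary_graph H"
    and f: "bij_betw f (verts ?B) (edges H)"
    and edge: "\<And>x y. x \<in> verts ?B \<Longrightarrow> y \<in> verts ?B \<Longrightarrow>
      {x, y} \<in> edges ?B \<longleftrightarrow> {f x, f y} \<in> edges (line_graph (mgraph_of H))"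
    using assms
    by (auto simp: is_line_graph_of_ordinary_graph_def graph_iso_def line_graph_def mgraph_of_def)
  have B: "proj {v} \<in> verts ?B" if "v \<in> verts G" for v using that by (simp add: verts_graph_bar)
  have fB: "f (proj {v}) \<in> edges H" if "v \<in> verts G" for v
    using B[OF that] f by (auto simp: bij_betw_def)
  define M where "M = \<lparr>mverts = verts H, medges = verts G, ends = (\<lambda>v. f (proj {v}))\<rparr>"
  have "multi_graph M"
    using H fB by (auto simp: multi_graph_def M_def ordinary_graph_def)
  moreover have "graph_iso G (line_graph M)"
    unfolding graph_iso_def
  proof (intro exI[of _ "\<lambda>x. x"] conjI ballI)
    show "bij_betw (\<lambda>x. x) (verts G) (verts (line_graph M))"
      by (simp add: line_graph_def M_def bij_betw_def)
    fix x y assume xy: "x \<in> verts G" "y \<in> verts G"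
    then have "{x, y} \<in> edges G \<longleftrightarrow> card (f (proj {x}) \<inter> f (proj {y})) = 1"
      using edge_graph_bar_iff[OF xy] edge[OF B B, OF xy] fB
      by (simp add: line_graph_edge_iff mgraph_of_def)
    then show "{x, y} \<in> edges G \<longleftrightarrow> {x, y} \<in> edges (line_graph M)"
      using xy by (simp add: line_graph_edge_iff M_def)
  qed
  ultimately show ?thesis by (rule line_graph_of_multi_graphI)
qed

end

theorem theorem2p5:
  fixes \<Gamma> :: "'a graph" and r :: "('a \<times> 'a) set"
  assumes "ordinary_graph \<Gamma>" and "connected_graph \<Gamma>"
    and "strict_linear_order_on (verts \<Gamma>) r"
  shows "(is_line_graph_of_multi_graph \<Gamma> \<longleftrightarrow> is_line_graph_of_ordinary_graph (graph_bar \<Gamma> r)) \<and>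
    (is_line_graph_of_ordinary_graph (graph_bar \<Gamma> r) \<longleftrightarrow>
      is_cotriangular_space_of_set (Pi_bar \<Gamma> r)) \<and>
    (is_cotriangular_space_of_set (Pi_bar \<Gamma> r) \<longleftrightarrow>
      \<not> (\<exists>S. pls_subspace (Pi_bar \<Gamma> r) S \<and> pls_iso (pls_restrict (Pi_bar \<Gamma> r) S) Pi_D4))"
proof -
  interpret ordered_graph \<Gamma> r using assms(1,3) by unfold_locales
  have "(\<exists>S. pls_subspace (Pi_bar \<Gamma> r) S \<and> pls_iso (pls_restrict (Pi_bar \<Gamma> r) S) Pi_D4) \<longleftrightarrow>
      (\<exists>a b c d. claw a b c d)"
    using claw_of_D4_subspace D4_subspace_of_claw by blast
  then show ?thesis
    using claw_free_if_line_graph cotriangular_if_claw_free[OF assms(2)]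
      line_graph_bar_if_cotriangular line_graph_if_line_graph_bar by blast
qed

end
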